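(* Let $L$ be a completely regular frame. The following are equivalent: (1) $L$ is almost Boolean. (2) $\mathrm{C}(L)$ is Dedekind complete and regular as a ring. (3) $\mathrm{C}(L)$ is universally complete.
   Context: Frames: $a^\ast=\bigvee\{b\mid a\wedge b=0\}$ is the pseudocomplement in a frame $L$; $a$ is complemented if $a\vee a^\ast=1$. Write $b\prec a$ if $b^\ast\vee a=1$, and $b\prec\!\!\prec a$ if there are $c_r\in L$ ($r\in\mathbb{Q}\cap[0,1]$) with $b\le c_0$, $c_1\le a$, $c_r\prec c_s$ for $r<s$. $L$ is regular if $a=\bigvee\{b\mid b\prec a\}$ for all $a$; completely regular if $a=\bigvee\{b\mid b\prec\!\!\prec a\}$ for all $a$; extremally disconnected if $a^\ast\vee a^{\ast\ast}=1$ for all $a$. $L$ is almost Boolean if it is regular, extremally disconnected, and the Boolean algebra of its complemented elements is closed under countable joins in $L$. The frame of reals $\mathfrak{L}(\mathbb{R})$ is the frame presented by generators $(p,-)$ and $(-,p)$, $p\in\mathbb{Q}$, with relations (r1) $(p,-)\wedge(-,q)=0$ if $p\ge q$; (r2) $(p,-)\vee(-,q)=1$ if $p<q$; (r3) $(p,-)=\bigvee_{q>p}(q,-)$; (r4) $(-,p)=\bigvee_{q<p}(-,q)$; (r5) $\bigvee_p(p,-)=1$; (r6) $\bigvee_p(-,p)=1$. Write $(p,q)=(p,-)\wedge(-,q)$. $\mathrm{C}(L)$ is the set of frame homomorphisms $\mathfrak{L}(\mathbb{R})\to L$, ordered by $f\le g$ iff $f(p,-)\le g(p,-)$ for all $p\in\mathbb{Q}$.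 For $\diamond\in\{+,\cdot,\wedge,\vee\}$, $(f\diamond g)(p,q)=\bigvee\{f(r,s)\wedge g(t,u)\mid \langle r,s\rangle\diamond\langle t,u\rangle\subseteq\langle p,q\rangle\}$, where $\langle\cdot,\cdot\rangle$ denotes open intervals of $\mathbb{Q}$ and the inclusion means $x\diamond y\in\langle p,q\rangle$ for all $x\in\langle r,s\rangle$, $y\in\langle t,u\rangle$; $(-f)(p,q)=f(-q,-p)$; for rational $\lambda>0$, $(\lambda f)(p,q)=f(p/\lambda,q/\lambda)$ (extending to real scalars). With these operations $\mathrm{C}(L)$ is a commutative ring with unit and an Archimedean Riesz space. A ring $R$ is regular if for each $a\in R$ there is $b\in R$ with $a=aba$. A Riesz space is Dedekind complete if every nonempty subset bounded above has a supremum; laterally complete if every nonempty set of pairwise disjoint positive elements has a supremum; universally complete if both. *)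

theory Defs
  imports Complex_Main "HOL-Library.FSet" "HOL-Library.Countable_Set"
begin

text \<open>The library class \<open>complete_distrib_lattice\<close> demands complete distributivity of
  meets over joins and joins over meets, which is stronger than the frame law.\<close>

class frame = complete_lattice +
  assumes inf_Sup_frame: "inf a (Sup B) = Sup (inf a ` B)"

definition pc :: "'a::frame \<Rightarrow> 'a" where
  "pc a = Sup {b. inf a b = bot}"

definition complemented :: "'a::frame \<Rightarrow> bool" where
  "complemented a \<longleftrightarrow> sup a (pc a) = top"

definition rather_below :: "'a::frame \<Rightarrow> 'a \<Rightarrow> bool" where
  "rather_below b a \<longleftrightarrow> sup (pc b) a = top"

definition completely_below :: "'a::frame \<Rightarrow> 'a \<Rightarrow> bool" where
  "completely_below b a \<longleftrightarrow>
    (\<exists>c :: rat \<Rightarrow> 'a. b \<le> c 0 \<and> c 1 \<le> a \<and>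
       (\<forall>r s. 0 \<le> r \<and> r < s \<and> s \<le> 1 \<longrightarrow> rather_below (c r) (c s)))"

definition regular_frame :: "'a::frame itself \<Rightarrow> bool" where
  "regular_frame _ \<longleftrightarrow> (\<forall>a::'a. a = Sup {b. rather_below b a})"

definition completely_regular_frame :: "'a::frame itself \<Rightarrow> bool" where
  "completely_regular_frame _ \<longleftrightarrow> (\<forall>a::'a. a = Sup {b. completely_below b a})"

definition extremally_disconnected :: "'a::frame itself \<Rightarrow> bool" where
  "extremally_disconnected _ \<longleftrightarrow> (\<forall>a::'a. sup (pc a) (pc (pc a)) = top)"

definition almost_Boolean :: "'a::frame itself \<Rightarrow> bool" where
  "almost_Boolean T \<longleftrightarrow> regular_frame T \<and> extremally_disconnected T \<and>
    (\<forall>A :: 'a set. countable A \<and> (\<forall>a\<in>A. complemented a) \<longrightarrow> complemented (Sup A))"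

definition frame_hom :: "('a::frame \<Rightarrow> 'b::frame) \<Rightarrow> bool" where
  "frame_hom h \<longleftrightarrow> (\<forall>A. h (Sup A) = Sup (h ` A)) \<and>
     (\<forall>a b. h (inf a b) = inf (h a) (h b)) \<and> h top = top"

text \<open>A finite set of generators stands for its meet, a set of finite sets for the join of
  these meets; closing it upwards makes the representation unique.\<close>

typedef 'g free_frame = "{U :: 'g fset set. \<forall>A\<in>U. \<forall>B. A |\<subseteq>| B \<longrightarrow> B \<in> U}"
  morphisms meets_of Abs_free_frame
  by blast

setup_lifting type_definition_free_frame

instantiation free_frame :: (type) frame
begin
lift_definition less_eq_free_frame :: "'a free_frame \<Rightarrow> 'a free_frame \<Rightarrow> bool" is "(\<subseteq>)" .
lift_definition less_free_frame :: "'a free_frame \<Rightarrow> 'a free_frame \<Rightarrow> bool" is "(\<subset>)" .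
lift_definition inf_free_frame :: "'a free_frame \<Rightarrow> 'a free_frame \<Rightarrow> 'a free_frame" is "(\<inter>)" by blast
lift_definition sup_free_frame :: "'a free_frame \<Rightarrow> 'a free_frame \<Rightarrow> 'a free_frame" is "(\<union>)" by blast
lift_definition Inf_free_frame :: "'a free_frame set \<Rightarrow> 'a free_frame" is "\<Inter>" by blast
lift_definition Sup_free_frame :: "'a free_frame set \<Rightarrow> 'a free_frame" is "\<Union>" by blast
lift_definition bot_free_frame :: "'a free_frame" is "{}" by blast
lift_definition top_free_frame :: "'a free_frame" is "UNIV" by blast
instance
proof
  fix x y z :: "'a free_frame" and A :: "'a free_frame set"
  show "x < y \<longleftrightarrow> x \<le> y \<and> \<not> y \<le> x" by transfer blast
  show "x \<le> x" by transfer blast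
  show "x \<le> y \<Longrightarrow> y \<le> z \<Longrightarrow> x \<le> z" by transfer blast
  show "x \<le> y \<Longrightarrow> y \<le> x \<Longrightarrow> x = y" by transfer blast
  show "inf x y \<le> x" "inf x y \<le> y" by (transfer, blast)+
  show "x \<le> y \<Longrightarrow> x \<le> z \<Longrightarrow> x \<le> inf y z" by transfer blast
  show "x \<le> sup x y" "y \<le> sup x y" by (transfer, blast)+
  show "y \<le> x \<Longrightarrow> z \<le> x \<Longrightarrow> sup y z \<le> x" by transfer blast
  show "x \<in> A \<Longrightarrow> Inf A \<le> x" "x \<in> A \<Longrightarrow> x \<le> Sup A" by (transfer, blast)+
  show "(\<And>x. x \<in> A \<Longrightarrow> z \<le> x) \<Longrightarrow> z \<le> Inf A"
    unfolding less_eq_free_frame.rep_eq Inf_free_frame.rep_eq by blast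
  show "(\<And>x. x \<in> A \<Longrightarrow> x \<le> z) \<Longrightarrow> Sup A \<le> z"
    unfolding less_eq_free_frame.rep_eq Sup_free_frame.rep_eq by blast
  show "Inf {} = (top :: 'a free_frame)" by transfer simp
  show "Sup {} = (bot :: 'a free_frame)" by transfer simp
  show "inf x (Sup A) = Sup (inf x ` A)" by transfer simp
qed
end

lift_definition gen :: "'g \<Rightarrow> 'g free_frame" is "\<lambda>g. {A. g |\<in>| A}" by blast

definition free_ext :: "('g \<Rightarrow> 'a::frame) \<Rightarrow> 'g free_frame \<Rightarrow> 'a" where
  "free_ext \<phi> U = Sup ((\<lambda>A. Inf (\<phi> ` fset A)) ` meets_of U)"

definition frame_congruence :: "('a::frame \<Rightarrow> 'a \<Rightarrow> bool) \<Rightarrow> bool" where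
  "frame_congruence R \<longleftrightarrow> equivp R \<and>
     (\<forall>a b c d. R a b \<longrightarrow> R c d \<longrightarrow> R (inf a c) (inf b d)) \<and>
     (\<forall>A B. rel_set R A B \<longrightarrow> R (Sup A) (Sup B))"

definition generated_congruence :: "('a::frame \<Rightarrow> 'a \<Rightarrow> bool) \<Rightarrow> 'a \<Rightarrow> 'a \<Rightarrow> bool" where
  "generated_congruence E a b \<longleftrightarrow> (\<forall>R. frame_congruence R \<longrightarrow> E \<le> R \<longrightarrow> R a b)"

lemma frame_congruence_generated: "frame_congruence (generated_congruence E)"
proof -
  let ?C = "generated_congruence E"
  have le: "?C a b \<Longrightarrow> frame_congruence R \<Longrightarrow> E \<le> R \<Longrightarrow> R a b" for a b R
    unfolding generated_congruence_def by blast
  have I: "?C a b" if "\<And>R. frame_congruence R \<Longrightarrow> E \<le> R \<Longrightarrow> R a b" for a b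
    using that unfolding generated_congruence_def by blast
  have eq: "frame_congruence R \<Longrightarrow> equivp R" for R :: "'a \<Rightarrow> 'a \<Rightarrow> bool"
    unfolding frame_congruence_def by blast
  have "equivp ?C"
  proof (rule equivpI)
    show "reflp ?C" by (rule reflpI, rule I) (rule equivp_reflp[OF eq])
    show "symp ?C" by (rule sympI, rule I) (rule equivp_symp[OF eq], assumption, rule le)
    show "transp ?C"
      by (rule transpI, rule I) (rule equivp_transp[OF eq], assumption, rule le, assumption+, rule le)
  qed
  moreover have "?C (inf a c) (inf b d)" if ab: "?C a b" and cd: "?C c d" for a b c d
  proof (rule I)
    fix R assume R: "frame_congruence R" "E \<le> R"
    show "R (inf a c) (inf b d)"
      using R(1) le[OF ab R] le[OF cd R] unfolding frame_congruence_def by simp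
  qed
  moreover have "?C (Sup A) (Sup B)" if AB: "rel_set ?C A B" for A B
  proof (rule I)
    fix R assume R: "frame_congruence R" "E \<le> R"
    have "rel_set R A B"
      using AB le[OF _ R] unfolding rel_set_def by meson
    then show "R (Sup A) (Sup B)" using R(1) unfolding frame_congruence_def by simp
  qed
  ultimately show ?thesis unfolding frame_congruence_def by simp
qed

lemma generated_congruence_base: "E a b \<Longrightarrow> generated_congruence E a b"
  unfolding generated_congruence_def by blast

text \<open>\<open>Ray_above p\<close> and \<open>Ray_below p\<close> are the generators \<open>(p,-)\<close> and \<open>(-,p)\<close>.\<close>

datatype real_gen = Ray_above rat | Ray_below rat

inductive real_rel :: "real_gen free_frame \<Rightarrow> real_gen free_frame \<Rightarrow> bool" where
  r1: "q \<le> p \<Longrightarrow> real_rel (inf (gen (Ray_above p)) (gen (Ray_below q))) bot"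
| r2: "p < q \<Longrightarrow> real_rel (sup (gen (Ray_above p)) (gen (Ray_below q))) top"
| r3: "real_rel (gen (Ray_above p)) (SUP q\<in>{p<..}. gen (Ray_above q))"
| r4: "real_rel (gen (Ray_below p)) (SUP q\<in>{..<p}. gen (Ray_below q))"
| r5: "real_rel (SUP p. gen (Ray_above p)) top"
| r6: "real_rel (SUP p. gen (Ray_below p)) top"

definition real_cong :: "real_gen free_frame \<Rightarrow> real_gen free_frame \<Rightarrow> bool" where
  "real_cong = generated_congruence real_rel"

lemma real_cong_congruence: "frame_congruence real_cong"
  unfolding real_cong_def by (rule frame_congruence_generated)

lemma real_cong_inf: "real_cong a b \<Longrightarrow> real_cong c d \<Longrightarrow> real_cong (inf a c) (inf b d)"
  and real_cong_Sup: "rel_set real_cong A B \<Longrightarrow> real_cong (Sup A) (Sup B)"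
  using real_cong_congruence unfolding frame_congruence_def by blast+

quotient_type real_frame = "real_gen free_frame" / real_cong
  morphisms rep_real_frame class_of
  using real_cong_congruence unfolding frame_congruence_def by blast

instantiation real_frame :: "{inf, Sup, top}"
begin
lift_definition inf_real_frame :: "real_frame \<Rightarrow> real_frame \<Rightarrow> real_frame" is inf
  by (rule real_cong_inf)
lift_definition Sup_real_frame :: "real_frame set \<Rightarrow> real_frame" is Sup
  by (rule real_cong_Sup)
lift_definition top_real_frame :: real_frame is top .
instance ..
end

instantiation real_frame :: "{order, bot, sup, Inf}"
begin
definition less_eq_real_frame :: "real_frame \<Rightarrow> real_frame \<Rightarrow> bool" where
  "less_eq_real_frame a b \<longleftrightarrow> inf a b = a"
definition less_real_frame :: "real_frame \<Rightarrow> real_frame \<Rightarrow> bool" where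
  "less_real_frame a b \<longleftrightarrow> a \<le> b \<and> \<not> b \<le> a"
definition bot_real_frame :: real_frame where "bot_real_frame = Sup {}"
definition sup_real_frame :: "real_frame \<Rightarrow> real_frame \<Rightarrow> real_frame" where
  "sup_real_frame a b = Sup {a, b}"
definition Inf_real_frame :: "real_frame set \<Rightarrow> real_frame" where
  "Inf_real_frame A = Sup {b. \<forall>a\<in>A. b \<le> a}"

lemma real_cong_refl: "real_cong a a"
  using real_cong_congruence unfolding frame_congruence_def by (blast intro: equivp_reflp)

lemma inf_real_frame_idem: "inf a a = (a::real_frame)"
  and inf_real_frame_comm: "inf a b = inf b (a::real_frame)"
  and inf_real_frame_assoc: "inf (inf a b) c = inf a (inf b (c::real_frame))"
  by (transfer; simp add: real_cong_refl inf.commute inf.left_commute)+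

instance
proof
  fix x y z :: real_frame
  show "x < y \<longleftrightarrow> x \<le> y \<and> \<not> y \<le> x" by (fact less_real_frame_def)
  show "x \<le> x" unfolding less_eq_real_frame_def by (fact inf_real_frame_idem)
  show "x \<le> y \<Longrightarrow> y \<le> z \<Longrightarrow> x \<le> z"
    unfolding less_eq_real_frame_def by (metis inf_real_frame_assoc)
  show "x \<le> y \<Longrightarrow> y \<le> x \<Longrightarrow> x = y"
    unfolding less_eq_real_frame_def by (metis inf_real_frame_comm)
qed
end

instance real_frame :: frame
proof
  fix x y z :: real_frame and A :: "real_frame set"
  have distr: "inf a (Sup B) = Sup (inf a ` B)" for a :: real_frame and B
    by transfer (simp add: inf_Sup_frame real_cong_refl)
  show "inf x (Sup A) = Sup (inf x ` A)" by (fact distr)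
  show lo1: "inf x y \<le> x" unfolding less_eq_real_frame_def
    by (metis inf_real_frame_assoc inf_real_frame_comm inf_real_frame_idem)
  show "inf x y \<le> y" unfolding less_eq_real_frame_def
    by (metis inf_real_frame_assoc inf_real_frame_idem)
  show "x \<le> y \<Longrightarrow> x \<le> z \<Longrightarrow> x \<le> inf y z" unfolding less_eq_real_frame_def
    by (metis inf_real_frame_assoc)
  have up: "a \<le> Sup B" if "a \<in> B" for a :: real_frame and B
  proof -
    have "inf a (Sup (insert a B)) = a"
      by transfer (simp add: inf_Sup_frame real_cong_refl inf_absorb1)
    with that show ?thesis unfolding less_eq_real_frame_def by (simp add: insert_absorb)
  qed
  have least: "Sup B \<le> c" if "\<And>a. a \<in> B \<Longrightarrow> a \<le> c" for c :: real_frame and B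
  proof -
    have "inf c ` B = B"
      using that unfolding less_eq_real_frame_def by (force simp: inf_real_frame_comm)
    then have "inf c (Sup B) = Sup B" by (simp add: distr)
    then show ?thesis unfolding less_eq_real_frame_def by (simp add: inf_real_frame_comm)
  qed
  show "x \<in> A \<Longrightarrow> x \<le> Sup A" by (fact up)
  show "(\<And>x. x \<in> A \<Longrightarrow> x \<le> z) \<Longrightarrow> Sup A \<le> z" by (fact least)
  show "x \<in> A \<Longrightarrow> Inf A \<le> x" unfolding Inf_real_frame_def by (auto intro: least)
  show "(\<And>x. x \<in> A \<Longrightarrow> z \<le> x) \<Longrightarrow> z \<le> Inf A" unfolding Inf_real_frame_def by (auto intro: up)
  show "x \<le> sup x y" "y \<le> sup x y" unfolding sup_real_frame_def by (auto intro: up)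
  show "y \<le> x \<Longrightarrow> z \<le> x \<Longrightarrow> sup y z \<le> x" unfolding sup_real_frame_def by (auto intro: least)
  show "Inf {} = (top :: real_frame)"
  proof (rule antisym)
    have top: "a \<le> top" for a :: real_frame
      unfolding less_eq_real_frame_def by transfer (simp add: real_cong_refl)
    show "Inf {} \<le> (top::real_frame)" by (fact top)
    show "top \<le> (Inf {} :: real_frame)" unfolding Inf_real_frame_def by (auto intro: up)
  qed
  show "Sup {} = (bot :: real_frame)" by (simp add: bot_real_frame_def)
qed

definition ray_above :: "rat \<Rightarrow> real_frame" where "ray_above p = class_of (gen (Ray_above p))"
definition ray_below :: "rat \<Rightarrow> real_frame" where "ray_below p = class_of (gen (Ray_below p))"
definition between :: "rat \<Rightarrow> rat \<Rightarrow> real_frame" where "between p q = inf (ray_above p) (ray_below q)"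

lemma frame_hom_Sup: "frame_hom h \<Longrightarrow> h (Sup A) = Sup (h ` A)"
  and frame_hom_inf: "frame_hom h \<Longrightarrow> h (inf a b) = inf (h a) (h b)"
  and frame_hom_top: "frame_hom h \<Longrightarrow> h top = top"
  unfolding frame_hom_def by blast+

lemma frame_hom_sup: "frame_hom h \<Longrightarrow> h (sup a b) = sup (h a) (h b)"
  using frame_hom_Sup[of h "{a, b}"] by simp

lemma frame_hom_bot: "frame_hom h \<Longrightarrow> h bot = bot"
  using frame_hom_Sup[of h "{}"] by simp

lemma frame_hom_comp: "frame_hom g \<Longrightarrow> frame_hom h \<Longrightarrow> frame_hom (\<lambda>x. g (h x))"
  by (simp add: frame_hom_def image_image)

lemma real_cong_rep: "real_cong x (rep_real_frame (class_of x))"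
  by (rule real_frame.abs_eq_iff[THEN iffD1])
     (simp add: Quotient_abs_rep[OF Quotient_real_frame])

lemma class_of_rep: "class_of (rep_real_frame x) = x"
  by (rule Quotient_abs_rep[OF Quotient_real_frame])

lemma frame_hom_class_of: "frame_hom class_of"
  unfolding frame_hom_def
proof (intro conjI allI)
  fix A
  have "rel_set real_cong A ((\<lambda>x. rep_real_frame (class_of x)) ` A)"
    unfolding rel_set_def using real_cong_rep by blast
  then have "class_of (Sup A) = class_of (Sup ((\<lambda>x. rep_real_frame (class_of x)) ` A))"
    using real_cong_Sup real_frame.abs_eq_iff by blast
  also have "\<dots> = Sup (class_of ` A)"
    unfolding Sup_real_frame_def by (simp only: map_fun_def image_image o_def id_apply)
  finally show "class_of (Sup A) = Sup (class_of ` A)" .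
next
  show "class_of (inf a b) = inf (class_of a) (class_of b)" for a b
    by (rule inf_real_frame.abs_eq[symmetric])
  show "class_of top = top" by (simp add: top_real_frame_def)
qed

lemma real_frame_r1: "q \<le> p \<Longrightarrow> inf (ray_above p) (ray_below q) = bot"
  and real_frame_r2: "p < q \<Longrightarrow> sup (ray_above p) (ray_below q) = top"
  and real_frame_r3: "ray_above p = (SUP q\<in>{p<..}. ray_above q)"
  and real_frame_r4: "ray_below p = (SUP q\<in>{..<p}. ray_below q)"
  and real_frame_r5: "(SUP p. ray_above p) = top"
  and real_frame_r6: "(SUP p. ray_below p) = top"
proof -
  note h = frame_hom_class_of
  note homs = frame_hom_inf[OF h] frame_hom_sup[OF h] frame_hom_bot[OF h] frame_hom_top[OF h]
    frame_hom_Sup[OF h] image_image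
  have eq: "class_of a = class_of b" if "real_rel a b" for a b
    using generated_congruence_base[of real_rel, OF that]
    unfolding real_cong_def[symmetric] by (rule real_frame.abs_eq_iff[THEN iffD2])
  show "q \<le> p \<Longrightarrow> inf (ray_above p) (ray_below q) = bot"
    using eq[OF r1] unfolding ray_above_def ray_below_def homs .
  show "p < q \<Longrightarrow> sup (ray_above p) (ray_below q) = top"
    using eq[OF r2] unfolding ray_above_def ray_below_def homs .
  show "ray_above p = (SUP q\<in>{p<..}. ray_above q)"
    using eq[OF r3] unfolding ray_above_def ray_below_def homs .
  show "ray_below p = (SUP q\<in>{..<p}. ray_below q)"
    using eq[OF r4] unfolding ray_above_def ray_below_def homs .
  show "(SUP p. ray_above p) = top"
    using eq[OF r5] unfolding ray_above_def ray_below_def homs .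
  show "(SUP p. ray_below p) = top"
    using eq[OF r6] unfolding ray_above_def ray_below_def homs .
qed

lemma Sup_inf_frame: "inf (Sup B) a = (SUP b\<in>B. inf b (a::'a::frame))"
  using inf_Sup_frame[of a B] by (simp add: inf.commute)

lemma meets_of_up: "A \<in> meets_of U \<Longrightarrow> A |\<subseteq>| B \<Longrightarrow> B \<in> meets_of U"
  using meets_of[of U] by simp

lemma frame_hom_free_ext: "frame_hom (free_ext (\<phi> :: 'g \<Rightarrow> 'a::frame))"
  unfolding frame_hom_def
proof (intro conjI allI)
  let ?I = "\<lambda>A. Inf (\<phi> ` fset A)"
  show "free_ext \<phi> (Sup X) = Sup (free_ext \<phi> ` X)" for X
    unfolding free_ext_def Sup_free_frame.rep_eq
    by (simp only: SUP_UNION image_image)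
  show "free_ext \<phi> (inf U V) = inf (free_ext \<phi> U) (free_ext \<phi> V)" for U V
  proof (rule antisym)
    show "free_ext \<phi> (inf U V) \<le> inf (free_ext \<phi> U) (free_ext \<phi> V)"
      unfolding free_ext_def inf_free_frame.rep_eq
      by (intro le_infI SUP_subset_mono) auto
    have "inf (?I A) (?I B) \<le> free_ext \<phi> (inf U V)" if "A \<in> meets_of U" "B \<in> meets_of V" for A B
    proof -
      have "A |\<union>| B \<in> meets_of U \<inter> meets_of V"
        using meets_of_up[OF that(1), of "A |\<union>| B"] meets_of_up[OF that(2), of "A |\<union>| B"] by simp
      then have "?I (A |\<union>| B) \<le> free_ext \<phi> (inf U V)"
        unfolding free_ext_def inf_free_frame.rep_eq by (rule SUP_upper)
      then show ?thesis by (simp add: image_Un Inf_union_distrib)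
    qed
    then show "inf (free_ext \<phi> U) (free_ext \<phi> V) \<le> free_ext \<phi> (inf U V)"
      unfolding free_ext_def[of _ U] free_ext_def[of _ V]
      by (auto simp: inf_Sup_frame Sup_inf_frame image_image intro!: SUP_least)
  qed
  have "?I {||} \<le> free_ext \<phi> top"
    unfolding free_ext_def top_free_frame.rep_eq by (rule SUP_upper) simp
  then show "free_ext \<phi> top = top" by (simp add: top_unique)
qed

lemma free_ext_gen: "free_ext \<phi> (gen g) = (\<phi> g :: 'a::frame)"
proof (rule antisym)
  show "free_ext \<phi> (gen g) \<le> \<phi> g"
    unfolding free_ext_def gen.rep_eq by (auto intro!: SUP_least INF_lower)
  have "Inf (\<phi> ` fset {|g|}) \<le> free_ext \<phi> (gen g)"
    unfolding free_ext_def gen.rep_eq by (rule SUP_upper) simp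
  then show "\<phi> g \<le> free_ext \<phi> (gen g)" by simp
qed

lemma meets_of_Inf_gen: "meets_of (Inf (gen ` fset A)) = {B. A |\<subseteq>| B}"
  by (auto simp: Inf_free_frame.rep_eq gen.rep_eq)

lemma free_frame_generated: "U = Sup ((\<lambda>A. Inf (gen ` fset A)) ` meets_of U)"
proof -
  have "meets_of U = (\<Union>A\<in>meets_of U. {B. A |\<subseteq>| B})" using meets_of_up[of _ U] by auto
  then have "meets_of U = meets_of (Sup ((\<lambda>A. Inf (gen ` fset A)) ` meets_of U))"
    by (simp add: Sup_free_frame.rep_eq image_image meets_of_Inf_gen)
  then show ?thesis by (simp only: meets_of_inject)
qed

lemma frame_hom_free_eq:
  assumes "frame_hom g" "frame_hom h" "\<And>x. g (gen x) = h (gen x)"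
  shows "g U = h U"
proof -
  have "g (Inf (gen ` fset A)) = h (Inf (gen ` fset A))" for A
    by (induction A) (simp_all add: assms frame_hom_top frame_hom_inf)
  then have "g (Sup ((\<lambda>A. Inf (gen ` fset A)) ` meets_of U))
    = h (Sup ((\<lambda>A. Inf (gen ` fset A)) ` meets_of U))"
    by (simp add: assms(1,2) frame_hom_Sup image_image)
  then show ?thesis by (simp only: free_frame_generated[symmetric])
qed

lemma real_frame_hom_eqI:
  assumes g: "frame_hom g" and h: "frame_hom h"
    and "\<And>p. g (ray_above p) = h (ray_above p)" "\<And>p. g (ray_below p) = h (ray_below p)"
  shows "g = h"
proof
  fix x
  have "g (class_of (gen y)) = h (class_of (gen y))" for y
    using assms(3,4) by (cases y) (simp_all add: ray_above_def ray_below_def)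
  from frame_hom_free_eq[OF frame_hom_comp[OF g frame_hom_class_of]
      frame_hom_comp[OF h frame_hom_class_of], OF this, of "rep_real_frame x"]
  show "g x = h x" by (simp only: class_of_rep)
qed

definition real_relations :: "(rat \<Rightarrow> 'a::frame) \<Rightarrow> (rat \<Rightarrow> 'a) \<Rightarrow> bool" where
  "real_relations a b \<longleftrightarrow>
     (\<forall>p q. q \<le> p \<longrightarrow> inf (a p) (b q) = bot) \<and>
     (\<forall>p q. p < q \<longrightarrow> sup (a p) (b q) = top) \<and>
     (\<forall>p. a p = (SUP q\<in>{p<..}. a q)) \<and>
     (\<forall>p. b p = (SUP q\<in>{..<p}. b q)) \<and>
     (SUP p. a p) = top \<and> (SUP p. b p) = top"

theorem real_frame_universal:
  assumes "real_relations a b"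
  shows "\<exists>!h. frame_hom h \<and> (\<forall>p. h (ray_above p) = a p \<and> h (ray_below p) = b p)"
proof (rule ex_ex1I)
  define \<phi> where "\<phi> = (\<lambda>x. case x of Ray_above p \<Rightarrow> a p | Ray_below p \<Rightarrow> b p)"
  let ?R = "\<lambda>U V. free_ext \<phi> U = free_ext \<phi> V"
  note e = frame_hom_free_ext[of \<phi>]
  note homs = frame_hom_inf[OF e] frame_hom_sup[OF e] frame_hom_bot[OF e] frame_hom_top[OF e]
    frame_hom_Sup[OF e] image_image free_ext_gen
  have "frame_congruence ?R"
    unfolding frame_congruence_def
  proof (intro conjI allI impI)
    show "equivp ?R" by (auto intro!: equivpI reflpI sympI transpI)
    show "?R (Sup A) (Sup B)" if "rel_set ?R A B" for A B
    proof -
      have "free_ext \<phi> ` A = free_ext \<phi> ` B" 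
      proof (intro equalityI image_subsetI)
        show "free_ext \<phi> a \<in> free_ext \<phi> ` B" if "a \<in> A" for a
          using rel_setD1[OF \<open>rel_set ?R A B\<close> that] by (metis imageI)
        show "free_ext \<phi> b \<in> free_ext \<phi> ` A" if "b \<in> B" for b
          using rel_setD2[OF \<open>rel_set ?R A B\<close> that] by (metis imageI)
      qed
      then show ?thesis by (simp only: homs)
    qed
  qed (simp add: homs)
  moreover have "real_rel \<le> ?R"
  proof (intro predicate2I)
    fix U V assume "real_rel U V"
    have g: "free_ext \<phi> (gen (Ray_above p)) = a p" "free_ext \<phi> (gen (Ray_below p)) = b p" for p
      by (simp_all add: free_ext_gen \<phi>_def)
    have rel: "q \<le> p \<Longrightarrow> inf (a p) (b q) = bot" "p < q \<Longrightarrow> sup (a p) (b q) = top"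
      "(SUP p. a p) = top" "(SUP p. b p) = top" for p q
      using assms unfolding real_relations_def by blast+
    from \<open>real_rel U V\<close> show "?R U V"
    proof cases
      case r1 then show ?thesis using rel by (simp add: homs(1-6) g)
    next
      case r2 then show ?thesis using rel by (simp add: homs(1-6) g)
    next
      case (r3 p)
      have "a p = (SUP q\<in>{p<..}. a q)" using assms unfolding real_relations_def by blast
      then show ?thesis unfolding r3 homs(1-6) g .
    next
      case (r4 p)
      have "b p = (SUP q\<in>{..<p}. b q)" using assms unfolding real_relations_def by blast
      then show ?thesis unfolding r4 homs(1-6) g .
    next
      case r5 then show ?thesis using rel by (simp add: homs(1-6) g)
    next
      case r6 then show ?thesis using rel by (simp add: homs(1-6) g)
    qed
  qed
  ultimately have R: "?R U V" if "real_cong U V" for U V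
    using that unfolding real_cong_def generated_congruence_def
    by (elim allE[of _ ?R] impE)
  define h where "h = (\<lambda>x. free_ext \<phi> (rep_real_frame x))"
  have hc: "h (class_of U) = free_ext \<phi> U" for U
    unfolding h_def using R[OF real_cong_rep] by simp
  have "frame_hom h"
    unfolding frame_hom_def
  proof (intro conjI allI)
    note c = frame_hom_class_of
    show "h (Sup A) = Sup (h ` A)" for A
    proof -
      have "Sup A = class_of (Sup (rep_real_frame ` A))"
        by (simp add: frame_hom_Sup[OF c] image_image class_of_rep)
      then show ?thesis by (simp add: hc homs) (simp add: h_def)
    qed
    show "h (inf x y) = inf (h x) (h y)" for x y
    proof -
      have "inf x y = class_of (inf (rep_real_frame x) (rep_real_frame y))"
        by (simp add: frame_hom_inf[OF c] class_of_rep)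
      then show ?thesis by (simp add: hc homs) (simp add: h_def)
    qed
    show "h top = top" using hc[of top] by (simp add: frame_hom_top[OF c] homs)
  qed
  moreover have "h (ray_above p) = a p" "h (ray_below p) = b p" for p
    by (simp_all add: ray_above_def ray_below_def hc homs \<phi>_def)
  ultimately show "\<exists>h. frame_hom h \<and> (\<forall>p. h (ray_above p) = a p \<and> h (ray_below p) = b p)" by blast
next
  show "g = h" if "frame_hom g \<and> (\<forall>p. g (ray_above p) = a p \<and> g (ray_below p) = b p)"
    "frame_hom h \<and> (\<forall>p. h (ray_above p) = a p \<and> h (ray_below p) = b p)" for g h
    using that by (auto intro!: real_frame_hom_eqI)
qed

lemma real_relations_const:
  "real_relations (\<lambda>p. if p < r then top else bot) (\<lambda>p. if r < p then top else bot :: 'a::frame)"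
proof -
  have "(SUP q\<in>{p<..}. if q < r then top else bot :: 'a) = (if p < r then top else bot)" for p
  proof (cases "p < r")
    case True
    then obtain s where "p < s" "s < r" using dense by blast
    then have "top \<le> (SUP q\<in>{p<..}. if q < r then top else bot :: 'a)"
      by (intro SUP_upper2[of s]) simp_all
    with True show ?thesis by (simp add: top_unique)
  next
    case False
    then have "(SUP q\<in>{p<..}. if q < r then top else bot :: 'a) \<le> bot"
      by (intro SUP_least) simp
    with False show ?thesis by (simp add: bot_unique)
  qed
  moreover have "(SUP q\<in>{..<p}. if r < q then top else bot :: 'a) = (if r < p then top else bot)" for p
  proof (cases "r < p")
    case True
    then obtain s where "r < s" "s < p" using dense by blast
    then have "top \<le> (SUP q\<in>{..<p}. if r < q then top else bot :: 'a)"
      by (intro SUP_upper2[of s]) simp_all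
    with True show ?thesis by (simp add: top_unique)
  next
    case False
    then have "(SUP q\<in>{..<p}. if r < q then top else bot :: 'a) \<le> bot"
      by (intro SUP_least) simp
    with False show ?thesis by (simp add: bot_unique)
  qed
  moreover have "(SUP q. if q < r then top else bot :: 'a) = top"
    by (rule top_le, rule SUP_upper2[of "r - 1"]) simp_all
  moreover have "(SUP q. if r < q then top else bot :: 'a) = top"
    by (rule top_le, rule SUP_upper2[of "r + 1"]) simp_all
  ultimately show ?thesis unfolding real_relations_def by auto
qed

typedef (overloaded) 'a cont = "{h :: real_frame \<Rightarrow> 'a::frame. frame_hom h}"
  morphisms ev Abs_cont
  using real_frame_universal[OF real_relations_const] unfolding Bex_def mem_Collect_eq by blast

lemma frame_hom_ev: "frame_hom (ev f)"
  using ev[of f] by simp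

instantiation cont :: (frame) order
begin
definition less_eq_cont :: "'a cont \<Rightarrow> 'a cont \<Rightarrow> bool" where
  "f \<le> g \<longleftrightarrow> (\<forall>p. ev f (ray_above p) \<le> ev g (ray_above p))"
definition less_cont :: "'a cont \<Rightarrow> 'a cont \<Rightarrow> bool" where
  "f < (g :: 'a cont) \<longleftrightarrow> f \<le> g \<and> \<not> g \<le> f"
instance
proof
  fix f g h :: "'a cont"
  show "f < g \<longleftrightarrow> f \<le> g \<and> \<not> g \<le> f" by (fact less_cont_def)
  show "f \<le> f" by (simp add: less_eq_cont_def)
  show "f \<le> g \<Longrightarrow> g \<le> h \<Longrightarrow> f \<le> h" by (meson less_eq_cont_def order_trans)
  assume "f \<le> g" "g \<le> f"
  then have ab: "ev f (ray_above p) = ev g (ray_above p)" for p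
    by (simp add: less_eq_cont_def antisym)
  have be: "ev f (ray_below q) \<le> ev g (ray_below q)"
    if ab: "\<And>p. ev f (ray_above p) = ev g (ray_above p)" for f g :: "'a cont" and q
  proof -
    note hf = frame_hom_ev[of f] and hg = frame_hom_ev[of g]
    have "ev f (ray_below s) \<le> ev g (ray_below q)" if "s < q" for s
    proof -
      have "inf (ev f (ray_above s)) (ev f (ray_below s)) = bot"
        by (simp flip: frame_hom_inf[OF hf] add: real_frame_r1 frame_hom_bot[OF hf])
      moreover have "sup (ev g (ray_above s)) (ev g (ray_below q)) = top"
        using that by (simp flip: frame_hom_sup[OF hg] add: real_frame_r2 frame_hom_top[OF hg])
      moreover have "inf (ev f (ray_below s)) (Sup {ev g (ray_above s), ev g (ray_below q)})
        = Sup {inf (ev f (ray_below s)) (ev g (ray_above s)), inf (ev f (ray_below s)) (ev g (ray_below q))}"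
        unfolding inf_Sup_frame by simp
      ultimately show ?thesis by (simp add: ab inf.commute le_iff_inf)
    qed
    then have "(SUP s\<in>{..<q}. ev f (ray_below s)) \<le> ev g (ray_below q)" by (auto intro: SUP_least)
    moreover have "ev f (ray_below q) = (SUP s\<in>{..<q}. ev f (ray_below s))"
      by (subst real_frame_r4) (simp add: frame_hom_Sup[OF hf] image_image)
    ultimately show ?thesis by simp
  qed
  have "ev f = ev g"
    using ab be[of f g] be[of g f] by (intro real_frame_hom_eqI frame_hom_ev antisym) auto
  then show "f = g" by (simp add: ev_inject)
qed
end

text \<open>The operations on continuous functions are given by their values on the elements
  \<open>(p,q)\<close>. A frame homomorphism on the frame of reals is determined by these,
  so that the descriptions below are unique.\<close>

lemma cont_eqI_between:
  assumes "\<And>p q. ev f (between p q) = ev g (between p q)"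
  shows "f = g"
proof -
  have a: "ray_above p = (SUP q. between p q)" for p
    using inf_Sup_frame[of "ray_above p" "range ray_below"] by (simp add: between_def real_frame_r6 image_image)
  have b: "ray_below q = (SUP p. between p q)" for q
    using Sup_inf_frame[of "range ray_above" "ray_below q"] by (simp add: between_def real_frame_r5 image_image)
  have "ev f = ev g"
    by (rule real_frame_hom_eqI[OF frame_hom_ev frame_hom_ev])
       (simp_all add: a b frame_hom_Sup[OF frame_hom_ev] image_image assms)
  then show ?thesis by (simp add: ev_inject)
qed

definition const :: "rat \<Rightarrow> 'a::frame cont" where
  "const r = (THE h. \<forall>p q. ev h (between p q) = (if p < r \<and> r < q then top else bot))"

lemma ev_const:
  "ev (const r :: 'a::frame cont) (between p q) = (if p < r \<and> r < q then top else bot)"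
proof -
  obtain h :: "real_frame \<Rightarrow> 'a" where h: "frame_hom h"
    "\<And>p. h (ray_above p) = (if p < r then top else bot)"
    "\<And>p. h (ray_below p) = (if r < p then top else bot)"
    using real_frame_universal[OF real_relations_const[of r]] by metis
  have ev: "\<forall>p q. ev (Abs_cont h) (between p q) = (if p < r \<and> r < q then top else bot)"
    using h by (simp add: Abs_cont_inverse between_def frame_hom_inf)
  have "\<forall>p q. ev (const r :: 'a cont) (between p q) = (if p < r \<and> r < q then top else bot)"
    unfolding const_def by (rule theI, rule ev, rule cont_eqI_between) (simp add: ev)
  then show ?thesis by blast
qed

text \<open>For \<open>s \<le> r\<close> or \<open>u \<le> t\<close> the inclusion of intervals holds vacuously, but then the meet is
  the bottom element and contributes nothing to the join.\<close>

definition pointwise :: "(rat \<Rightarrow> rat \<Rightarrow> rat) \<Rightarrow> 'a::frame cont \<Rightarrow> 'a cont \<Rightarrow> 'a cont" where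
  "pointwise op f g = (THE h. \<forall>p q. ev h (between p q) =
     Sup {inf (ev f (between r s)) (ev g (between t u)) | r s t u.
            \<forall>x\<in>{r<..<s}. \<forall>y\<in>{t<..<u}. op x y \<in> {p<..<q}})"

instantiation cont :: (frame) "{zero, one, plus, times, uminus, inf, sup}"
begin
definition zero_cont :: "'a cont" where "0 = const 0"
definition one_cont :: "'a cont" where "1 = const 1"
definition plus_cont :: "'a cont \<Rightarrow> 'a cont \<Rightarrow> 'a cont" where "plus_cont = pointwise (+)"
definition times_cont :: "'a cont \<Rightarrow> 'a cont \<Rightarrow> 'a cont" where "times_cont = pointwise (*)"
definition inf_cont :: "'a cont \<Rightarrow> 'a cont \<Rightarrow> 'a cont" where "inf_cont = pointwise min"
definition sup_cont :: "'a cont \<Rightarrow> 'a cont \<Rightarrow> 'a cont" where "sup_cont = pointwise max"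
definition uminus_cont :: "'a cont \<Rightarrow> 'a cont" where
  "- f = (THE h. \<forall>p q. ev h (between p q) = ev f (between (- q) (- p)))"
instance ..
end

text \<open>Regularity of a ring involves only its product, and completeness of a Riesz space only its
  order, its zero and its binary meets; the type classes are restricted accordingly, and scalar
  multiplication on \<open>'a cont\<close> is not needed.\<close>

definition regular_ring :: "'r::times itself \<Rightarrow> bool" where
  "regular_ring _ \<longleftrightarrow> (\<forall>a::'r. \<exists>b. a = a * b * a)"

definition has_supremum :: "'r::order set \<Rightarrow> bool" where
  "has_supremum S \<longleftrightarrow> (\<exists>s. (\<forall>x\<in>S. x \<le> s) \<and> (\<forall>u. (\<forall>x\<in>S. x \<le> u) \<longrightarrow> s \<le> u))"

definition Dedekind_complete :: "'r::order itself \<Rightarrow> bool" where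
  "Dedekind_complete _ \<longleftrightarrow> (\<forall>S::'r set. S \<noteq> {} \<and> bdd_above S \<longrightarrow> has_supremum S)"

definition laterally_complete :: "'r::{order,zero,inf} itself \<Rightarrow> bool" where
  "laterally_complete _ \<longleftrightarrow>
     (\<forall>S::'r set. S \<noteq> {} \<and> (\<forall>x\<in>S. 0 \<le> x) \<and> pairwise (\<lambda>x y. inf x y = 0) S
        \<longrightarrow> has_supremum S)"

definition universally_complete :: "'r::{order,zero,inf} itself \<Rightarrow> bool" where
  "universally_complete T \<longleftrightarrow> Dedekind_complete T \<and> laterally_complete T"

end

(*
A function is determined by its upper rays, and every antitone family V with V p rather below V q
for q < p and with joins of V and of pc V equal to top yields one; if the V p are complemented,
antitonicity suffices. Over an extremally disconnected frame a pointwise supremum therefore has the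
rays pc (pc (SUP x. x(p,-))), provided that the complements of these cover, which holds for bounded
sets and, if complemented elements are closed under countable joins, for disjoint sets. Over an
almost Boolean frame all rays of f are complemented, so that 1/f on the cozero part extends by 0 to
a quasi-inverse.

Conversely, the supremum of all f <= 1 that vanish off a is the indicator of the closure of a, so
that Dedekind completeness gives extremal disconnectedness. A quasi-inverse g of f >= 0 makes f * g
the indicator of the cozero part of f, which may be any countable join of complemented elements.
Lateral completeness gives the same closure property by summing n times the indicators of the
disjointified pieces.
*)
theory Submission
  imports Defs
begin

section \<open>Frames\<close>

\<comment> \<open>The frame law at two-element joins is one half of binary distributivity, and in
  any lattice that half implies the other.\<close>
subclass (in frame) distrib_lattice
proof
  have "inf a (sup b c) = sup (inf a b) (inf a c)" for a b c :: 'a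
    using inf_Sup_frame[of a "{b, c}"] by simp
  then show "sup x (inf y z) = inf (sup x y) (sup x z)" for x y z :: 'a
    by (rule distrib_imp1)
qed

lemma inf_Sup_le: "(\<And>x. x \<in> A \<Longrightarrow> inf b x \<le> z) \<Longrightarrow> inf b (Sup A) \<le> (z::'a::frame)"
  unfolding inf_Sup_frame by (auto intro: SUP_least)

lemma inf_Sup_eq_bot:
  "inf b (Sup A) = (bot::'a::frame) \<longleftrightarrow> (\<forall>x\<in>A. inf b x = bot)"
proof
  show "inf b (Sup A) = bot \<Longrightarrow> \<forall>x\<in>A. inf b x = bot"
    using Sup_upper by (metis bot_unique inf_mono order_refl)
  show "\<forall>x\<in>A. inf b x = bot \<Longrightarrow> inf b (Sup A) = bot"
    using inf_Sup_le[of A b bot] by (simp add: bot_unique)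
qed

text \<open>Meeting \<open>c\<close> with the cover \<open>sup a b\<close> leaves only
  \<open>inf c b\<close>. Many inequalities below arise in this way, with a cover supplied by
  (r2).\<close>

lemma le_of_disjoint:
  assumes "sup a b = top" "inf c a = (bot::'a::frame)"
  shows "c \<le> b"
proof -
  have "c = inf c (sup a b)" by (simp add: assms(1))
  also have "\<dots> = inf c b" by (simp add: inf_sup_distrib1 assms(2))
  finally show ?thesis by (simp add: le_iff_inf)
qed

text \<open>By the frame law the join that defines \<open>pc a\<close> is itself disjoint from
  \<open>a\<close>.\<close>

lemma le_pc_iff: "b \<le> pc a \<longleftrightarrow> inf a b = (bot::'a::frame)"
proof
  have "inf a (pc a) = bot" unfolding pc_def by (simp add: inf_Sup_eq_bot)
  then show "b \<le> pc a \<Longrightarrow> inf a b = bot" by (metis bot_unique inf_mono order_refl)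
  show "inf a b = bot \<Longrightarrow> b \<le> pc a" unfolding pc_def by (simp add: Sup_upper)
qed

lemma inf_pc [simp]: "inf a (pc a) = (bot::'a::frame)"
  using le_pc_iff[of "pc a" a] by simp

lemma pc_inf [simp]: "inf (pc a) a = (bot::'a::frame)"
  by (simp add: inf.commute)

lemma pc_antimono: "a \<le> b \<Longrightarrow> pc b \<le> pc (a::'a::frame)"
  unfolding le_pc_iff by (metis bot_unique inf_mono inf_pc order_refl)

lemma le_pc_pc: "a \<le> pc (pc (a::'a::frame))"
  by (simp add: le_pc_iff)

lemma pc_pc_pc [simp]: "pc (pc (pc a)) = pc (a::'a::frame)"
  by (simp add: antisym le_pc_pc pc_antimono)

lemma pc_bot [simp]: "pc bot = (top::'a::frame)"
  by (rule top_le) (simp add: le_pc_iff)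

lemma pc_top [simp]: "pc top = (bot::'a::frame)"
  using inf_pc[of top] unfolding inf_top_left .

text \<open>\<open>b\<close> lies below \<open>pc a\<close>, which is its own double
  pseudocomplement. Passing to closures thus preserves disjointness.\<close>

lemma pc_pc_disjoint: "inf a b = bot \<Longrightarrow> inf (pc (pc a)) b = (bot::'a::frame)"
  by (metis inf.commute inf_pc le_pc_iff pc_pc_pc)

lemma disjoint_mono:
  "inf c d = bot \<Longrightarrow> a \<le> c \<Longrightarrow> b \<le> d \<Longrightarrow> inf a b = (bot::'a::frame)"
  by (metis bot_unique inf_mono)

lemma pc_eqI:
  assumes "sup a b = top" "inf a b = (bot::'a::frame)"
  shows "pc a = b"
  by (rule antisym) (auto simp: le_pc_iff assms intro: le_of_disjoint[OF assms(1)])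

section \<open>Complemented elements\<close>

lemma complementedI: "sup a b = top \<Longrightarrow> inf a b = bot \<Longrightarrow> complemented (a::'a::frame)"
  by (simp add: complemented_def pc_eqI)

lemma complemented_pc: "complemented a \<Longrightarrow> complemented (pc (a::'a::frame))"
  by (rule complementedI[of _ a]) (simp_all add: complemented_def sup.commute)

lemma complemented_sup:
  assumes "complemented a" "complemented (b::'a::frame)"
  shows "complemented (sup a b)"
proof (rule complementedI)
  show "sup (sup a b) (inf (pc a) (pc b)) = top"
    using assms unfolding complemented_def
    by (simp add: sup_inf_distrib1 sup.assoc) (simp add: sup.left_commute[of a b])
  show "inf (sup a b) (inf (pc a) (pc b)) = bot"
    using disjoint_mono[OF inf_pc[of a], of a "inf (pc a) (pc b)"]
      disjoint_mono[OF inf_pc[of b], of b "inf (pc a) (pc b)"]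
    by (simp add: inf_sup_distrib2)
qed

lemma complemented_inf:
  assumes "complemented a" "complemented (b::'a::frame)"
  shows "complemented (inf a b)"
proof (rule complementedI)
  show "sup (inf a b) (sup (pc a) (pc b)) = top"
    using assms unfolding complemented_def
    by (simp add: sup_inf_distrib2 sup.left_commute[of b "pc a"]) (simp flip: sup.assoc)
  show "inf (inf a b) (sup (pc a) (pc b)) = bot"
    using disjoint_mono[OF inf_pc[of a], of "inf a b" "pc a"]
      disjoint_mono[OF inf_pc[of b], of "inf a b" "pc b"]
    by (simp add: inf_sup_distrib1)
qed

lemma complemented_bot [simp]: "complemented (bot::'a::frame)"
  and complemented_top [simp]: "complemented (top::'a::frame)"
  by (simp_all add: complemented_def)

lemma pc_pc_complemented: "complemented a \<Longrightarrow> pc (pc a) = (a::'a::frame)"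
  by (rule pc_eqI) (simp_all add: complemented_def sup.commute)

lemma complemented_dense: "complemented a \<Longrightarrow> pc a = bot \<Longrightarrow> a = (top::'a::frame)"
  by (simp add: complemented_def)

section \<open>The relations rather below and completely below\<close>

lemma rather_below_le: "rather_below b a \<Longrightarrow> b \<le> (a::'a::frame)"
  unfolding rather_below_def by (rule le_of_disjoint) auto

lemma rather_below_mono:
  "rather_below b a \<Longrightarrow> b' \<le> b \<Longrightarrow> a \<le> a' \<Longrightarrow> rather_below b' (a'::'a::frame)"
  unfolding rather_below_def by (metis pc_antimono sup_mono top_le)

text \<open>A complemented element is rather below itself. For families of complemented elements the
  first hypothesis of \<open>scale_cont\<close> thereby reduces to antitonicity.\<close>

lemma rather_below_complemented:
  "complemented b \<Longrightarrow> b \<le> a \<Longrightarrow> rather_below b (a::'a::frame)"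
  by (rule rather_below_mono[of b b]) (simp_all add: rather_below_def complemented_def sup.commute)

lemma rather_below_pc: "rather_below b a \<Longrightarrow> rather_below (pc a) (pc (b::'a::frame))"
  unfolding rather_below_def by (metis le_pc_pc sup.commute sup_mono order_refl top_le)

lemma completely_below_imp_rather_below: "completely_below b a \<Longrightarrow> rather_below b (a::'a::frame)"
proof -
  assume "completely_below b a"
  then obtain c :: "rat \<Rightarrow> 'a" where "b \<le> c 0" "c 1 \<le> a"
    and "\<forall>r s. 0 \<le> r \<and> r < s \<and> s \<le> 1 \<longrightarrow> rather_below (c r) (c s)"
    unfolding completely_below_def by blast
  then show ?thesis by (intro rather_below_mono[of "c 0" "c 1" b a]) auto
qed

section \<open>Continuous functions\<close>

abbreviation ev_above :: "'a::frame cont \<Rightarrow> rat \<Rightarrow> 'a" where "ev_above f p \<equiv> ev f (ray_above p)"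
abbreviation ev_below :: "'a::frame cont \<Rightarrow> rat \<Rightarrow> 'a" where "ev_below f p \<equiv> ev f (ray_below p)"

lemma above_below_disjoint: "q \<le> p \<Longrightarrow> inf (ev_above f p) (ev_below f q) = bot"
  by (simp flip: frame_hom_inf[OF frame_hom_ev] add: real_frame_r1 frame_hom_bot[OF frame_hom_ev])

lemma above_sup_below: "p < q \<Longrightarrow> sup (ev_above f p) (ev_below f q) = top"
  by (simp flip: frame_hom_sup[OF frame_hom_ev] add: real_frame_r2 frame_hom_top[OF frame_hom_ev])

lemma above_SUP: "ev_above f p = (SUP q\<in>{p<..}. ev_above f q)"
  by (subst real_frame_r3) (simp add: frame_hom_Sup[OF frame_hom_ev] image_image)

lemma below_SUP: "ev_below f p = (SUP q\<in>{..<p}. ev_below f q)"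
  by (subst real_frame_r4) (simp add: frame_hom_Sup[OF frame_hom_ev] image_image)

lemma SUP_above: "(SUP p. ev_above f p) = top"
  using frame_hom_Sup[OF frame_hom_ev, of f "range ray_above"]
  by (simp add: image_image real_frame_r5 frame_hom_top[OF frame_hom_ev])

lemma SUP_below: "(SUP p. ev_below f p) = top"
  using frame_hom_Sup[OF frame_hom_ev, of f "range ray_below"]
  by (simp add: image_image real_frame_r6 frame_hom_top[OF frame_hom_ev])

lemma above_antimono: "p \<le> q \<Longrightarrow> ev_above f q \<le> ev_above f p"
  by (subst (1 2) above_SUP) (intro SUP_subset_mono; auto)

lemma below_mono: "p \<le> q \<Longrightarrow> ev_below f p \<le> ev_below f q"
  by (subst (1 2) below_SUP) (intro SUP_subset_mono; auto)

lemma ev_between: "ev f (between p q) = inf (ev_above f p) (ev_below f q)"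
  by (simp add: between_def frame_hom_inf[OF frame_hom_ev])

lemma ev_between_empty: "q \<le> p \<Longrightarrow> ev f (between p q) = bot"
  by (simp add: ev_between above_below_disjoint)

lemma inf_above: "inf (ev_above f p) (ev_above f q) = ev_above f (max p q)"
  using above_antimono[of p q f] above_antimono[of q p f]
  by (cases "p \<le> q") (auto simp: inf_absorb1 inf_absorb2 max_def)

lemma inf_below: "inf (ev_below f p) (ev_below f q) = ev_below f (min p q)"
  using below_mono[of p q f] below_mono[of q p f]
  by (cases "p \<le> q") (auto simp: inf_absorb1 inf_absorb2 min_def)

lemma inf_between:
  "inf (ev f (between r s)) (ev f (between r' s')) = ev f (between (max r r') (min s s'))"
  unfolding ev_between inf_above[symmetric] inf_below[symmetric]
  by (simp add: inf.assoc inf.left_commute)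

lemma above_between: "ev_above f p = (SUP q. ev f (between p q))"
  using inf_Sup_frame[of "ev_above f p" "range (ev_below f)"]
  by (simp add: ev_between image_image SUP_below)

lemma below_between: "ev_below f q = (SUP p. ev f (between p q))"
  using Sup_inf_frame[of "range (ev_above f)" "ev_below f q"]
  by (simp add: ev_between image_image SUP_above)

text \<open>By (r3) and (r4) an interval is the join of the intervals strictly inside it, and
  meeting with \<open>b\<close> preserves these joins.\<close>

lemma between_leI:
  assumes "\<And>r' s'. r < r' \<Longrightarrow> r' < s' \<Longrightarrow> s' < s \<Longrightarrow> inf (ev f (between r' s')) b \<le> z"
  shows "inf (ev f (between r s)) b \<le> z"
proof -
  have *: "inf (inf (ev_above f r') (ev_below f s')) b \<le> z" if "r < r'" "s' < s" for r' s'
    using assms[OF that(1) _ that(2)] ev_between_empty[of s' r' f]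
    by (cases "r' < s'") (auto simp: ev_between)
  have "inf (inf b (ev_below f s')) (ev_above f r) \<le> z" if "s' < s" for s'
    by (subst above_SUP) (rule inf_Sup_le, use * that in \<open>auto simp: ac_simps\<close>)
  then have "inf (inf b (ev_above f r)) (ev_below f s) \<le> z"
    by (subst below_SUP) (rule inf_Sup_le, auto simp: ac_simps)
  then show ?thesis by (simp add: ev_between ac_simps)
qed

lemma top_le_betweens:
  assumes "\<And>r s. inf (ev f (between r s)) b \<le> z"
  shows "b \<le> z"
proof -
  have "inf (inf b (ev_above f r)) (SUP s. ev_below f s) \<le> z" for r
    by (rule inf_Sup_le) (use assms[of r] in \<open>auto simp: ev_between ac_simps\<close>)
  then have "inf b (SUP r. ev_above f r) \<le> z"
    by (intro inf_Sup_le) (auto simp: SUP_below)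
  then show ?thesis by (simp add: SUP_above)
qed

text \<open>Any interval is exhausted by a chain of overlapping intervals of length
  \<open>d\<close>, and all intervals together cover by (r5) and (r6).\<close>

lemma between_cover:
  assumes "0 < d"
  shows "(SUP r. ev f (between r (r + d))) = top"
proof -
  let ?C = "SUP r. ev f (between r (r + d))"
  \<comment> \<open>Advancing by half of \<open>d\<close> leaves the overlap that (r2) needs, its
    inequality being strict.\<close>
  define e where "e = d / 2"
  have e: "0 < e" "d = e + e" using assms by (auto simp: e_def)
  have step: "ev f (between a (a + of_nat k * e)) \<le> ?C" for a and k :: nat
  proof (induction k arbitrary: a)
    case 0
    then show ?case by (simp add: ev_between_empty)
  next
    case (Suc k)
    have eq: "a + of_nat (Suc k) * e = (a + e) + of_nat k * e" by (simp add: algebra_simps)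
    have "ev_above f a \<le> sup (ev_above f (a + e)) (ev f (between a (a + d)))"
      using above_sup_below[of "a + e" "a + d" f] e by (simp add: ev_between sup_inf_distrib1)
    then have "ev f (between a (a + of_nat (Suc k) * e))
      \<le> inf (sup (ev_above f (a + e)) (ev f (between a (a + d)))) (ev_below f ((a + e) + of_nat k * e))"
      unfolding ev_between eq by (intro inf_mono) auto
    also have "\<dots> \<le> sup (ev f (between (a + e) ((a + e) + of_nat k * e))) (ev f (between a (a + d)))"
      unfolding ev_between[of f "a + e"] inf_sup_distrib2 by (intro sup_mono) auto
    also have "\<dots> \<le> ?C"
      by (intro sup_least Suc.IH SUP_upper UNIV_I)
    finally show ?case .
  qed
  have "inf (ev f (between a b)) top \<le> ?C" for a b
  proof -
    obtain k :: nat where "b - a < of_nat k * e" using ex_less_of_nat_mult[OF e(1)] by blast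
    then have "ev f (between a b) \<le> ev f (between a (a + of_nat k * e))"
      unfolding ev_between by (intro inf_mono below_mono) auto
    also note step
    finally show ?thesis by simp
  qed
  then have "top \<le> ?C" by (rule top_le_betweens)
  then show ?thesis by (simp add: top_unique)
qed

text \<open>The form in which uniform continuity enters: estimates are made on short intervals
  only.\<close>

lemma inf_between_cover:
  assumes "0 < d" "\<And>r. inf (ev f (between r (r + d))) b \<le> z"
  shows "b \<le> z"
proof -
  have "inf b (SUP r. ev f (between r (r + d))) \<le> z"
    by (rule inf_Sup_le) (use assms(2) in \<open>auto simp: inf.commute\<close>)
  then show ?thesis by (simp add: between_cover[OF assms(1)])
qed

section \<open>Construction and comparison of continuous functions\<close>

lemma real_relations_cont:
  assumes "real_relations a b"
  obtains f where "\<And>p. ev_above f p = a p" "\<And>p. ev_below f p = b p"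
  using real_frame_universal[OF assms] by (metis Abs_cont_inverse mem_Collect_eq)

text \<open>Choosing \<open>V\<close> between the open and the closed rays of a function
  makes the strictness relations (r3) and (r4) automatic.\<close>

lemma scale_cont:
  fixes V :: "rat \<Rightarrow> 'a::frame"
  assumes rb: "\<And>p q. q < p \<Longrightarrow> rather_below (V p) (V q)"
    and tops: "(SUP p. V p) = top" "(SUP p. pc (V p)) = top"
  obtains f where "\<And>p. ev_above f p = (SUP q\<in>{p<..}. V q)" "\<And>p. ev_below f p = (SUP q\<in>{..<p}. pc (V q))"
proof (rule real_relations_cont)
  show "real_relations (\<lambda>p. SUP q\<in>{p<..}. V q) (\<lambda>p. SUP q\<in>{..<p}. pc (V q))"
    unfolding real_relations_def
  proof (intro conjI allI impI)
    fix p q :: rat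
    show "inf (SUP q\<in>{p<..}. V q) (SUP r\<in>{..<q}. pc (V r)) = bot" if "q \<le> p"
    proof -
      have "inf (V r) (pc (V s)) = bot" if "p < r" "s < q" for r s
        using rather_below_le[OF rb[of s r]] \<open>q \<le> p\<close> that by (intro disjoint_mono[OF inf_pc]) auto
      then have "inf (V r) (SUP s\<in>{..<q}. pc (V s)) = bot" if "p < r" for r
        using that by (simp add: inf_Sup_eq_bot)
      then show ?thesis by (simp add: Sup_inf_frame image_image bot_unique)
    qed
    show "sup (SUP q\<in>{p<..}. V q) (SUP r\<in>{..<q}. pc (V r)) = top" if pq: "p < q"
    proof -
      \<comment> \<open>With two intermediate points, \<open>V s\<close> belongs to the left join
        and \<open>pc (V r)\<close> to the right one; they cover because \<open>V r\<close> is
        rather below \<open>V s\<close>.\<close>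
      obtain s where s: "p < s" "s < q" using dense[OF pq] by blast
      obtain r where r: "s < r" "r < q" using dense[OF s(2)] by blast
      have "sup (V s) (pc (V r)) \<le> sup (SUP q\<in>{p<..}. V q) (SUP r\<in>{..<q}. pc (V r))"
        using s r by (intro sup_mono SUP_upper) auto
      moreover have "sup (V s) (pc (V r)) = top"
        using rb[OF r(1)] by (simp add: rather_below_def sup.commute)
      ultimately show ?thesis by (simp only: top_unique)
    qed
    show "(SUP q\<in>{p<..}. V q) = (SUP q\<in>{p<..}. SUP r\<in>{q<..}. V r)"
    proof (intro antisym SUP_least)
      fix q assume "q \<in> {p<..}"
      then obtain r where "p < r" "r < q" using dense by auto
      then show "V q \<le> (SUP q\<in>{p<..}. SUP r\<in>{q<..}. V r)"
        by (intro SUP_upper2[of r] SUP_upper) auto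
    qed (auto intro: SUP_upper)
    show "(SUP q\<in>{..<p}. pc (V q)) = (SUP q\<in>{..<p}. SUP r\<in>{..<q}. pc (V r))"
    proof (intro antisym SUP_least)
      fix q assume "q \<in> {..<p}"
      then obtain r where "q < r" "r < p" using dense by auto
      then show "pc (V q) \<le> (SUP q\<in>{..<p}. SUP r\<in>{..<q}. pc (V r))"
        by (intro SUP_upper2[of r] SUP_upper) auto
    qed (auto intro: SUP_upper)
    have "V p \<le> (SUP p. SUP q\<in>{p<..}. V q)" for p
      by (intro SUP_upper2[of "p - 1"] SUP_upper) auto
    then have "(SUP p. V p) \<le> (SUP p. SUP q\<in>{p<..}. V q)" by (rule SUP_least)
    then show "(SUP p. SUP q\<in>{p<..}. V q) = top" by (simp add: tops top_unique)
    have "pc (V p) \<le> (SUP p. SUP q\<in>{..<p}. pc (V q))" for p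
      by (intro SUP_upper2[of "p + 1"] SUP_upper) auto
    then have "(SUP p. pc (V p)) \<le> (SUP p. SUP q\<in>{..<p}. pc (V q))" by (rule SUP_least)
    then show "(SUP p. SUP q\<in>{..<p}. pc (V q)) = top" by (simp add: tops top_unique)
  qed
qed blast

text \<open>(r2) turns disjointness from \<open>ev_below g q\<close> into containment in
  \<open>ev_above g p\<close> for \<open>p < q\<close>, and (r3) closes the gap between
  \<open>p\<close> and \<open>r\<close>.\<close>

lemma cont_leI:
  assumes "\<And>q r. q < r \<Longrightarrow> inf (ev_above f r) (ev_below g q) = bot"
  shows "f \<le> g"
  unfolding less_eq_cont_def
proof
  fix p
  have "ev_above f r \<le> ev_above g p" if "p < r" for r
  proof -
    obtain q where "p < q" "q < r" using dense[OF \<open>p < r\<close>] by blast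
    then show ?thesis
      using le_of_disjoint[of "ev_below g q" "ev_above g p" "ev_above f r"] assms above_sup_below[of p q g]
      by (simp add: sup.commute)
  qed
  then show "ev_above f p \<le> ev_above g p" by (subst above_SUP) (auto intro: SUP_least)
qed

lemma above_const: "ev_above (const r :: 'a::frame cont) p = (if p < r then top else bot)"
proof -
  have "ev_above (const r :: 'a cont) p = (SUP q. if p < r \<and> r < q then top else bot)"
    unfolding above_between ev_const ..
  moreover have "(SUP q. if p < r \<and> r < q then top else bot :: 'a) = top" if "p < r"
    using that by (intro top_le SUP_upper2[of "r + 1"]) auto
  ultimately show ?thesis by auto
qed

lemma nonneg_cont_iff: "0 \<le> f \<longleftrightarrow> (\<forall>p<0. ev_above (f::'a::frame cont) p = top)"
  by (auto simp: less_eq_cont_def zero_cont_def above_const top_unique)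

lemma cont_eqI:
  assumes "\<And>p. ev_above f p = ev_above g p"
  shows "f = g"
  by (rule antisym) (simp_all add: less_eq_cont_def assms)

section \<open>Products and meets of continuous functions\<close>

text \<open>The join from \<open>pointwise\<close> with an arbitrary region \<open>P\<close> of the
  rational plane in place of the preimage of an interval. It plays the part of the preimage of the
  interior of \<open>P\<close> under the pair of \<open>f\<close> and \<open>g\<close>.\<close>

definition rects :: "(rat \<Rightarrow> rat \<Rightarrow> bool) \<Rightarrow> 'a::frame cont \<Rightarrow> 'a cont \<Rightarrow> 'a" where
  "rects P f g = Sup {inf (ev f (between r s)) (ev g (between t u)) | r s t u.
     \<forall>x\<in>{r<..<s}. \<forall>y\<in>{t<..<u}. P x y}"

lemma rects_upper:
  "(\<And>x y. r < x \<Longrightarrow> x < s \<Longrightarrow> t < y \<Longrightarrow> y < u \<Longrightarrow> P x y) \<Longrightarrow>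
    inf (ev f (between r s)) (ev g (between t u)) \<le> rects P f g"
  unfolding rects_def by (rule Sup_upper) fastforce

lemma rects_leI:
  assumes "\<And>r s t u. r < s \<Longrightarrow> t < u \<Longrightarrow>
    (\<And>x y. r < x \<Longrightarrow> x < s \<Longrightarrow> t < y \<Longrightarrow> y < u \<Longrightarrow> P x y) \<Longrightarrow>
    inf (ev f (between r s)) (ev g (between t u)) \<le> z"
  shows "rects P f g \<le> z"
  unfolding rects_def
proof (rule Sup_least, clarify)
  fix r s t u :: rat assume "\<forall>x\<in>{r<..<s}. \<forall>y\<in>{t<..<u}. P x y"
  then show "inf (ev f (between r s)) (ev g (between t u)) \<le> z"
    using assms[of r s t u] ev_between_empty[of s r f] ev_between_empty[of u t g]
    by (cases "r < s \<and> t < u") (auto simp: not_less)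
qed

lemma rects_mono: "(\<And>x y. P x y \<Longrightarrow> Q x y) \<Longrightarrow> rects P f g \<le> rects Q f g"
  by (rule rects_leI) (auto intro: rects_upper)

lemma inf_inf_swap: "inf (inf a b) (inf c d) = inf (inf a c) (inf b (d::'a::semilattice_inf))"
  by (simp add: ac_simps)

text \<open>The intersection of two rectangles is a rectangle on which both conditions hold. This
  recovers values on intervals from values on rays.\<close>

lemma inf_rects: "inf (rects P f g) (rects Q f g) = rects (\<lambda>x y. P x y \<and> Q x y) f g"
proof (rule antisym)
  have "inf (inf (ev f (between r s)) (ev g (between t u))) (rects Q f g)
      \<le> rects (\<lambda>x y. P x y \<and> Q x y) f g"
    if P: "\<And>x y. r < x \<Longrightarrow> x < s \<Longrightarrow> t < y \<Longrightarrow> y < u \<Longrightarrow> P x y" for r s t u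
    unfolding rects_def[of Q]
  proof (rule inf_Sup_le, clarify)
    fix r' s' t' u' :: rat assume "\<forall>x\<in>{r'<..<s'}. \<forall>y\<in>{t'<..<u'}. Q x y"
    then show "inf (inf (ev f (between r s)) (ev g (between t u)))
        (inf (ev f (between r' s')) (ev g (between t' u'))) \<le> rects (\<lambda>x y. P x y \<and> Q x y) f g"
      unfolding inf_inf_swap[of "ev f (between r s)"] inf_between
      using P by (intro rects_upper) auto
  qed
  then have "inf (rects Q f g) (rects P f g) \<le> rects (\<lambda>x y. P x y \<and> Q x y) f g"
    unfolding rects_def[of P] by (intro inf_Sup_le) (auto simp: inf.commute)
  then show "inf (rects P f g) (rects Q f g) \<le> rects (\<lambda>x y. P x y \<and> Q x y) f g"
    by (simp add: inf.commute)
qed (intro le_infI rects_mono; simp)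

lemma rects_empty: "(\<And>x y. \<not> P x y) \<Longrightarrow> rects P f g = bot"
  by (rule bot_unique[THEN iffD1], rule rects_leI) (meson dense)

text \<open>The description in \<open>pointwise\<close> has at most one solution by
  \<open>cont_eqI_between\<close>, so exhibiting any solution identifies it.\<close>

lemma ev_pointwise:
  assumes "\<And>p q. ev h (between p q) = rects (\<lambda>x y. op x y \<in> {p<..<q}) f g"
  shows "pointwise op f g = h"
  unfolding pointwise_def
proof (rule the_equality)
  show eq: "\<forall>p q. ev h (between p q) = Sup {inf (ev f (between r s)) (ev g (between t u)) | r s t u.
            \<forall>x\<in>{r<..<s}. \<forall>y\<in>{t<..<u}. op x y \<in> {p<..<q}}"
    using assms unfolding rects_def by blast
  then show "\<And>k. \<forall>p q. ev k (between p q) = Sup {inf (ev f (between r s)) (ev g (between t u)) | r s t u.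
            \<forall>x\<in>{r<..<s}. \<forall>y\<in>{t<..<u}. op x y \<in> {p<..<q}} \<Longrightarrow> k = h"
    by (intro cont_eqI_between) simp
qed

text \<open>Of the relations for the two families of regions, (r1) is automatic, since no point lies
  in both regions. The hypotheses are (r2), the nontrivial inclusions of (r3) and (r4), and (r5) and
  (r6).\<close>

lemma pointwise_cont:
  assumes cover: "\<And>p q. p < q \<Longrightarrow>
      sup (rects (\<lambda>x y. p < op x y) f g) (rects (\<lambda>x y. op x y < q) f g) = top"
    and shrink: "\<And>p. rects (\<lambda>x y. p < op x y) f g \<le> (SUP q\<in>{p<..}. rects (\<lambda>x y. q < op x y) f g)"
      "\<And>p. rects (\<lambda>x y. op x y < p) f g \<le> (SUP q\<in>{..<p}. rects (\<lambda>x y. op x y < q) f g)"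
    and bounds: "(SUP p. rects (\<lambda>x y. p < op x y) f g) = top"
      "(SUP p. rects (\<lambda>x y. op x y < p) f g) = top"
  shows "ev_above (pointwise op f g) p = rects (\<lambda>x y. p < op x y) f g"
    and "ev_below (pointwise op f g) p = rects (\<lambda>x y. op x y < p) f g"
proof -
  have "real_relations (\<lambda>p. rects (\<lambda>x y. p < op x y) f g) (\<lambda>p. rects (\<lambda>x y. op x y < p) f g)"
    unfolding real_relations_def
  proof (intro conjI allI impI cover bounds antisym shrink)
    show "inf (rects (\<lambda>x y. p < op x y) f g) (rects (\<lambda>x y. op x y < q) f g) \<le> bot" if "q \<le> p" for p q
      unfolding inf_rects using that by (subst rects_empty) auto
  qed (auto intro!: SUP_least rects_mono)
  then obtain h where h: "\<And>p. ev_above h p = rects (\<lambda>x y. p < op x y) f g"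
      "\<And>p. ev_below h p = rects (\<lambda>x y. op x y < p) f g"
    by (rule real_relations_cont) blast
  have "pointwise op f g = h"
    by (rule ev_pointwise) (simp add: ev_between h inf_rects)
  then show "ev_above (pointwise op f g) p = rects (\<lambda>x y. p < op x y) f g"
    "ev_below (pointwise op f g) p = rects (\<lambda>x y. op x y < p) f g"
    by (simp_all add: h)
qed

text \<open>In \<open>x\<close> the product is monotone or antitone, according to the sign of
  \<open>y\<close>.\<close>

lemma min_mult_le:
  fixes a b x y :: rat
  assumes "a \<le> x" "x \<le> b"
  shows "min (a * y) (b * y) \<le> x * y" "x * y \<le> max (a * y) (b * y)"
proof -
  have "a * y \<le> x * y \<and> x * y \<le> b * y" if "0 \<le> y"
    using assms that by (simp add: mult_right_mono)
  moreover have "b * y \<le> x * y \<and> x * y \<le> a * y" if "y \<le> 0"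
    using assms that by (simp add: mult_right_mono_neg)
  ultimately show "min (a * y) (b * y) \<le> x * y" "x * y \<le> max (a * y) (b * y)"
    by (meson linear min.coboundedI1 min.coboundedI2 max.coboundedI1 max.coboundedI2)+
qed

text \<open>The extrema of a product over a closed rectangle are attained at the corners.\<close>

lemma mult_shrink_above:
  fixes p :: rat
  assumes P: "\<And>x y. r < x \<Longrightarrow> x < s \<Longrightarrow> t < y \<Longrightarrow> y < u \<Longrightarrow> p < x * y"
    and "r < r'" "r' < s'" "s' < s" "t < t'" "t' < u'" "u' < u"
  shows "\<exists>q>p. \<forall>x y. r' < x \<longrightarrow> x < s' \<longrightarrow> t' < y \<longrightarrow> y < u' \<longrightarrow> q < x * y"
proof -
  define m where "m = min (min (r' * t') (r' * u')) (min (s' * t') (s' * u'))"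
  \<comment> \<open>The corners of the inner rectangle lie inside the open outer one.\<close>
  have "p < m" using assms(2-) by (auto simp: m_def intro!: P)
  then obtain q where q: "p < q" "q < m" using dense by blast
  have "m \<le> x * y" if "r' < x" "x < s'" "t' < y" "y < u'" for x y
    using min_mult_le(1)[of r' x s' y] min_mult_le(1)[of t' y u' r'] min_mult_le(1)[of t' y u' s'] that
    unfolding m_def by (simp add: mult.commute min_le_iff_disj) linarith
  with q show ?thesis by (meson less_le_trans)
qed

text \<open>Reflecting \<open>x\<close> to \<open>- x\<close> exchanges the two directions.\<close>

lemma mult_shrink_below:
  fixes p :: rat
  assumes P: "\<And>x y. r < x \<Longrightarrow> x < s \<Longrightarrow> t < y \<Longrightarrow> y < u \<Longrightarrow> x * y < p"
    and "r < r'" "r' < s'" "s' < s" "t < t'" "t' < u'" "u' < u"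
  shows "\<exists>q<p. \<forall>x y. r' < x \<longrightarrow> x < s' \<longrightarrow> t' < y \<longrightarrow> y < u' \<longrightarrow> x * y < q"
proof -
  have "- p < x * y" if "- s < x" "x < - r" "t < y" "y < u" for x y
    using P[of "- x" y] that by simp
  then have "\<exists>q>-p. \<forall>x y. - s' < x \<longrightarrow> x < - r' \<longrightarrow> t' < y \<longrightarrow> y < u' \<longrightarrow> q < x * y"
    using assms(2-) by (intro mult_shrink_above[of "- s" "- r" t u]) auto
  then obtain q where q: "- p < q"
      "\<And>x y. - s' < x \<Longrightarrow> x < - r' \<Longrightarrow> t' < y \<Longrightarrow> y < u' \<Longrightarrow> q < x * y"
    by blast
  have "x * y < - q" if "r' < x" "x < s'" "t' < y" "y < u'" for x y
    using q(2)[of "- x" y] that by simp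
  with q(1) show ?thesis by (intro exI[of _ "- q"]) auto
qed

text \<open>Applying \<open>between_leI\<close> to both factors leaves a margin around the inner
  rectangle; for products this margin yields (r3) and (r4).\<close>

lemma rects_inner:
  assumes "\<And>r s t u r' s' t' u'. (\<And>x y. r < x \<Longrightarrow> x < s \<Longrightarrow> t < y \<Longrightarrow> y < u \<Longrightarrow> P x y) \<Longrightarrow>
    r < r' \<Longrightarrow> r' < s' \<Longrightarrow> s' < s \<Longrightarrow> t < t' \<Longrightarrow> t' < u' \<Longrightarrow> u' < u \<Longrightarrow>
    inf (ev f (between r' s')) (ev g (between t' u')) \<le> z"
  shows "rects P f g \<le> z"
proof (rule rects_leI)
  fix r s t u :: rat assume "r < s" "t < u"
    and P: "\<And>x y. r < x \<Longrightarrow> x < s \<Longrightarrow> t < y \<Longrightarrow> y < u \<Longrightarrow> P x y"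
  show "inf (ev f (between r s)) (ev g (between t u)) \<le> z"
  proof (rule between_leI)
    fix r' s' assume rs: "r < r'" "r' < s'" "s' < s"
    have "inf (ev g (between t u)) (ev f (between r' s')) \<le> z"
    proof (rule between_leI)
      fix t' u' assume "t < t'" "t' < u'" "u' < u"
      from assms[OF P rs this] show "inf (ev g (between t' u')) (ev f (between r' s')) \<le> z"
        by (simp add: inf.commute)
    qed
    then show "inf (ev f (between r' s')) (ev g (between t u)) \<le> z" by (simp add: inf.commute)
  qed
qed

lemma top_le_between_between:
  assumes "\<And>r s t u. inf (ev f (between r s)) (ev g (between t u)) \<le> z"
  shows "z = top"
proof -
  have "inf (ev g (between t u)) top \<le> z" for t u
    using top_le_betweens[of f "ev g (between t u)" z] assms by simp
  then show ?thesis by (metis top_le top_le_betweens)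
qed

text \<open>Bounded rectangles cover, and each is covered by small rectangles inside it. The size
  \<open>d\<close> may depend on the bound \<open>N\<close>, as suits operations that are uniformly
  continuous on bounded sets only.\<close>

lemma small_rectangles_cover:
  fixes f g :: "'a::frame cont"
  assumes "\<And>N::rat. 1 \<le> N \<Longrightarrow> \<exists>d>0. \<forall>r s t u. - N \<le> r \<longrightarrow> r < s \<longrightarrow> s \<le> N \<longrightarrow> - N \<le> t \<longrightarrow> t < u \<longrightarrow> u \<le> N \<longrightarrow>
      s - r \<le> d \<longrightarrow> u - t \<le> d \<longrightarrow> inf (ev f (between r s)) (ev g (between t u)) \<le> z"
  shows "z = top"
proof (rule top_le_between_between)
  fix r s t u :: rat
  define N where "N = Max {1, \<bar>r\<bar>, \<bar>s\<bar>, \<bar>t\<bar>, \<bar>u\<bar>}"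
  have N: "1 \<le> N" "\<bar>r\<bar> \<le> N" "\<bar>s\<bar> \<le> N" "\<bar>t\<bar> \<le> N" "\<bar>u\<bar> \<le> N"
    unfolding N_def by (simp_all add: le_max_iff_disj)
  obtain d where d: "0 < d" and small: "\<And>r s t u. - N \<le> r \<Longrightarrow> r < s \<Longrightarrow> s \<le> N \<Longrightarrow> - N \<le> t \<Longrightarrow> t < u \<Longrightarrow> u \<le> N \<Longrightarrow>
      s - r \<le> d \<Longrightarrow> u - t \<le> d \<Longrightarrow> inf (ev f (between r s)) (ev g (between t u)) \<le> z"
    using assms[OF N(1)] by blast
  show "inf (ev f (between r s)) (ev g (between t u)) \<le> z"
  \<comment> \<open>Cutting both sides by intervals of length \<open>d\<close> leaves subrectangles
    of the original one, so they stay within \<open>N\<close>.\<close>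
  proof (rule inf_between_cover[OF d, of f], rule inf_between_cover[OF d, of g])
    fix a b
    let ?r = "max r b" and ?s = "min s (b + d)" and ?t = "max t a" and ?u = "min u (a + d)"
    have "inf (ev g (between a (a + d))) (inf (ev f (between b (b + d)))
        (inf (ev f (between r s)) (ev g (between t u))))
      = inf (ev f (between ?r ?s)) (ev g (between ?t ?u))"
      unfolding inf_between[symmetric] by (simp add: ac_simps)
    also have "\<dots> \<le> z"
    proof (cases "?r < ?s \<and> ?t < ?u")
      case True
      then show ?thesis using N by (intro small) (auto simp: abs_le_iff min_def max_def)
    next
      case False
      then show ?thesis
        using ev_between_empty[of ?s ?r f] ev_between_empty[of ?u ?t g]
        by (auto simp only: not_less de_Morgan_conj inf_bot_left inf_bot_right bot_least)
    qed
    finally show "inf (ev g (between a (a + d))) (inf (ev f (between b (b + d)))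
        (inf (ev f (between r s)) (ev g (between t u)))) \<le> z" .
  qed
qed

text \<open>On such a rectangle the product differs from \<open>r * t\<close> by at most
  \<open>2 * N * d\<close>, a quarter of \<open>q - p\<close>. The side of the midpoint of
  \<open>p\<close> and \<open>q\<close> on which \<open>r * t\<close> lies therefore decides the
  alternative.\<close>

lemma mult_oscillation:
  fixes N :: rat
  assumes N: "1 \<le> N" and pq: "p < q" and d: "d = (q - p) / (8 * N)"
    and b: "- N \<le> r" "s \<le> N" "- N \<le> t" "u \<le> N" "s - r \<le> d" "u - t \<le> d" "r < s" "t < u"
  shows "(\<forall>x y. r < x \<longrightarrow> x < s \<longrightarrow> t < y \<longrightarrow> y < u \<longrightarrow> p < x * y) \<or>
         (\<forall>x y. r < x \<longrightarrow> x < s \<longrightarrow> t < y \<longrightarrow> y < u \<longrightarrow> x * y < q)"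
proof -
  have *: "\<bar>x * y - r * t\<bar> \<le> (q - p) / 4" if "r < x" "x < s" "t < y" "y < u" for x y
  proof -
    have "x * y - r * t = x * (y - t) + t * (x - r)" by (simp add: algebra_simps)
    then have "\<bar>x * y - r * t\<bar> \<le> \<bar>x\<bar> * \<bar>y - t\<bar> + \<bar>t\<bar> * \<bar>x - r\<bar>"
      by (metis abs_mult abs_triangle_ineq)
    also have "\<dots> \<le> N * d + N * d"
      using that b N by (intro add_mono mult_mono) (auto simp: abs_le_iff)
    also have "\<dots> = (q - p) / 4" using N by (simp add: d field_simps)
    finally show ?thesis .
  qed
  show ?thesis
  proof (cases "(p + q) / 2 \<le> r * t")
    case True
    have "p < x * y" if "r < x" "x < s" "t < y" "y < u" for x y
      using *[OF that] True pq unfolding abs_le_iff by (simp add: field_simps)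
    then show ?thesis by blast
  next
    case False
    have "x * y < q" if "r < x" "x < s" "t < y" "y < u" for x y
      using *[OF that] False pq unfolding abs_le_iff by (simp add: field_simps)
    then show ?thesis by blast
  qed
qed

lemma abs_mult_bound:
  fixes N :: rat
  assumes "- N \<le> r" "s \<le> N" "- N \<le> t" "u \<le> N" "r < x" "x < s" "t < y" "y < u"
  shows "\<bar>x * y\<bar> < N * N + 1"
proof -
  have "\<bar>x * y\<bar> \<le> N * N"
    unfolding abs_mult using assms by (intro mult_mono) (auto simp: abs_le_iff)
  then show ?thesis by simp
qed

text \<open>For multiplication (r2) is uniform continuity on bounded rectangles, (r3) and (r4)
  follow by shrinking rectangles, and (r5) and (r6) from boundedness on them.\<close>

lemma above_times: "ev_above (f * g) p = rects (\<lambda>x y. p < x * y) f g"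
  and below_times: "ev_below (f * g) p = rects (\<lambda>x y. x * y < p) f g"
proof -
  have cover: "sup (rects (\<lambda>x y. p < x * y) f g) (rects (\<lambda>x y. x * y < q) f g) = top"
    if pq: "p < q" for p q
  proof (rule small_rectangles_cover[of f g])
    fix N :: rat assume N: "1 \<le> N"
    have "inf (ev f (between r s)) (ev g (between t u))
        \<le> sup (rects (\<lambda>x y. p < x * y) f g) (rects (\<lambda>x y. x * y < q) f g)"
      if "- N \<le> r" "r < s" "s \<le> N" "- N \<le> t" "t < u" "u \<le> N"
        "s - r \<le> (q - p) / (8 * N)" "u - t \<le> (q - p) / (8 * N)" for r s t u
      using mult_oscillation[OF N pq refl that(1,3,4,6,7,8,2,5)]
      by (elim disjE) (rule le_supI1, rule rects_upper, blast, rule le_supI2, rule rects_upper, blast)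
    then show "\<exists>d>0. \<forall>r s t u. - N \<le> r \<longrightarrow> r < s \<longrightarrow> s \<le> N \<longrightarrow> - N \<le> t \<longrightarrow> t < u \<longrightarrow> u \<le> N \<longrightarrow>
        s - r \<le> d \<longrightarrow> u - t \<le> d \<longrightarrow> inf (ev f (between r s)) (ev g (between t u))
          \<le> sup (rects (\<lambda>x y. p < x * y) f g) (rects (\<lambda>x y. x * y < q) f g)"
      using N pq by (intro exI[of _ "(q - p) / (8 * N)"]) simp
  qed
  have shrink_above: "rects (\<lambda>x y. p < x * y) f g \<le> (SUP q\<in>{p<..}. rects (\<lambda>x y. q < x * y) f g)" for p
  proof (rule rects_inner)
    fix r s t u r' s' t' u' :: rat
    assume "\<And>x y. r < x \<Longrightarrow> x < s \<Longrightarrow> t < y \<Longrightarrow> y < u \<Longrightarrow> p < x * y"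
      and "r < r'" "r' < s'" "s' < s" "t < t'" "t' < u'" "u' < u"
    from mult_shrink_above[OF this] obtain q where "p < q"
      "\<And>x y. r' < x \<Longrightarrow> x < s' \<Longrightarrow> t' < y \<Longrightarrow> y < u' \<Longrightarrow> q < x * y" by blast
    then show "inf (ev f (between r' s')) (ev g (between t' u'))
        \<le> (SUP q\<in>{p<..}. rects (\<lambda>x y. q < x * y) f g)"
      by (intro SUP_upper2[of q] rects_upper) auto
  qed
  have shrink_below: "rects (\<lambda>x y. x * y < p) f g \<le> (SUP q\<in>{..<p}. rects (\<lambda>x y. x * y < q) f g)" for p
  proof (rule rects_inner)
    fix r s t u r' s' t' u' :: rat
    assume "\<And>x y. r < x \<Longrightarrow> x < s \<Longrightarrow> t < y \<Longrightarrow> y < u \<Longrightarrow> x * y < p"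
      and "r < r'" "r' < s'" "s' < s" "t < t'" "t' < u'" "u' < u"
    from mult_shrink_below[OF this] obtain q where "q < p"
      "\<And>x y. r' < x \<Longrightarrow> x < s' \<Longrightarrow> t' < y \<Longrightarrow> y < u' \<Longrightarrow> x * y < q" by blast
    then show "inf (ev f (between r' s')) (ev g (between t' u'))
        \<le> (SUP q\<in>{..<p}. rects (\<lambda>x y. x * y < q) f g)"
      by (intro SUP_upper2[of q] rects_upper) auto
  qed
  have bound_above: "(SUP p. rects (\<lambda>x y. p < x * y) f g) = top"
  proof (rule small_rectangles_cover[of f g], intro exI[of _ 1] conjI allI impI)
    fix N r s t u :: rat assume b: "- N \<le> r" "s \<le> N" "- N \<le> t" "u \<le> N"
    show "inf (ev f (between r s)) (ev g (between t u)) \<le> (SUP p. rects (\<lambda>x y. p < x * y) f g)"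
      by (rule SUP_upper2[of "- (N * N + 1)"], simp, rule rects_upper,
        drule (3) abs_mult_bound[OF b]) (simp add: abs_less_iff)
  qed simp
  have bound_below: "(SUP p. rects (\<lambda>x y. x * y < p) f g) = top"
  proof (rule small_rectangles_cover[of f g], intro exI[of _ 1] conjI allI impI)
    fix N r s t u :: rat assume b: "- N \<le> r" "s \<le> N" "- N \<le> t" "u \<le> N"
    show "inf (ev f (between r s)) (ev g (between t u)) \<le> (SUP p. rects (\<lambda>x y. x * y < p) f g)"
      by (rule SUP_upper2[of "N * N + 1"], simp, rule rects_upper,
        drule (3) abs_mult_bound[OF b]) (simp add: abs_less_iff)
  qed simp
  note * = pointwise_cont[of "(*)", OF cover shrink_above shrink_below bound_above bound_below]
  show "ev_above (f * g) p = rects (\<lambda>x y. p < x * y) f g"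
    unfolding times_cont_def by (rule *(1))
  show "ev_below (f * g) p = rects (\<lambda>x y. x * y < p) f g"
    unfolding times_cont_def by (rule *(2))
qed

lemma between_times: "ev (f * g) (between p q) = rects (\<lambda>x y. p < x * y \<and> x * y < q) f g"
  by (simp add: ev_between above_times below_times inf_rects)

lemma above_inf: "ev_above (inf f g) p = inf (ev_above f p) (ev_above g p)"
proof -
  have "real_relations (\<lambda>p. inf (ev_above f p) (ev_above g p)) (\<lambda>p. sup (ev_below f p) (ev_below g p))"
    unfolding real_relations_def
  proof (intro conjI allI impI)
    fix p q :: rat
    show "inf (inf (ev_above f p) (ev_above g p)) (sup (ev_below f q) (ev_below g q)) = bot" if "q \<le> p"
      using disjoint_mono[OF above_below_disjoint[OF that, of f], of "inf (ev_above f p) (ev_above g p)"]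
        disjoint_mono[OF above_below_disjoint[OF that, of g], of "inf (ev_above f p) (ev_above g p)"]
      by (simp add: inf_sup_distrib1)
    show "sup (inf (ev_above f p) (ev_above g p)) (sup (ev_below f q) (ev_below g q)) = top" if "p < q"
    proof -
      have "sup (ev_above f p) (sup (ev_below f q) (ev_below g q)) = top"
        by (simp add: above_sup_below[OF that] flip: sup.assoc)
      moreover have "sup (ev_above g p) (sup (ev_below f q) (ev_below g q)) = top"
        by (subst sup.left_commute) (simp add: above_sup_below[OF that])
      ultimately show ?thesis by (simp add: sup_inf_distrib2)
    qed
    show "inf (ev_above f p) (ev_above g p) = (SUP q\<in>{p<..}. inf (ev_above f q) (ev_above g q))"
    proof (rule antisym)
      have "inf (ev_above f r) (ev_above g s) \<le> (SUP q\<in>{p<..}. inf (ev_above f q) (ev_above g q))"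
        if "p < r" "p < s" for r s
        using that by (intro SUP_upper2[of "min r s"] inf_mono above_antimono) auto
      then have "inf (ev_above g s) (ev_above f p) \<le> (SUP q\<in>{p<..}. inf (ev_above f q) (ev_above g q))"
        if "p < s" for s
        using that by (subst above_SUP, intro inf_Sup_le) (auto simp: inf.commute)
      then show "inf (ev_above f p) (ev_above g p) \<le> (SUP q\<in>{p<..}. inf (ev_above f q) (ev_above g q))"
        by (subst above_SUP[of g], intro inf_Sup_le) (auto simp: inf.commute)
    qed (auto intro!: SUP_least le_infI intro: le_infI1[OF above_antimono] le_infI2[OF above_antimono])
    show "sup (ev_below f p) (ev_below g p) = (SUP q\<in>{..<p}. sup (ev_below f q) (ev_below g q))"
      by (subst (1 2) below_SUP) (simp add: complete_lattice_class.SUP_sup_distrib)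
    have "inf (ev_above f r) (ev_above g s) \<le> (SUP q. inf (ev_above f q) (ev_above g q))" for r s
      by (intro SUP_upper2[of "min r s"] inf_mono above_antimono) auto
    then have "inf (ev f (between r s)) (ev g (between t u)) \<le> (SUP q. inf (ev_above f q) (ev_above g q))"
      for r s t u
      unfolding ev_between by (meson inf_le1 inf_mono order_trans)
    then show "(SUP q. inf (ev_above f q) (ev_above g q)) = top"
      by (rule top_le_between_between)
    show "(SUP q. sup (ev_below f q) (ev_below g q)) = top"
      by (simp add: complete_lattice_class.SUP_sup_distrib[symmetric] SUP_below)
  qed
  then obtain h where h: "\<And>p. ev_above h p = inf (ev_above f p) (ev_above g p)"
      "\<And>p. ev_below h p = sup (ev_below f p) (ev_below g p)"
    by (rule real_relations_cont) blast
  have "pointwise min f g = h"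
  proof (rule ev_pointwise, rule antisym)
    fix p q :: rat
    let ?R = "rects (\<lambda>x y. min x y \<in> {p<..<q}) f g"
    \<comment> \<open>A minimum lies strictly between \<open>p\<close> and \<open>q\<close> iff both
      values exceed \<open>p\<close> and one of them is below \<open>q\<close>. The two choices give
      two families of rectangles.\<close>
    have "inf (ev f (between p q)) (ev g (between p u)) \<le> ?R" for u
      by (rule rects_upper) (auto simp: min_def)
    then have "inf (ev f (between p q)) (ev_above g p) \<le> ?R"
      unfolding above_between[of g] by (intro inf_Sup_le) auto
    moreover have "inf (ev g (between p q)) (ev f (between p u)) \<le> ?R" for u
      unfolding inf.commute[of "ev g _"] by (rule rects_upper) (auto simp: min_def)
    then have "inf (ev g (between p q)) (ev_above f p) \<le> ?R"
      unfolding above_between[of f] by (intro inf_Sup_le) auto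
    ultimately show "ev h (between p q) \<le> ?R"
      by (simp add: ev_between h inf_sup_distrib1 ac_simps)
    show "?R \<le> ev h (between p q)"
    proof (rule rects_leI)
      fix r s t u :: rat assume "r < s" "t < u"
        and P: "\<And>x y. r < x \<Longrightarrow> x < s \<Longrightarrow> t < y \<Longrightarrow> y < u \<Longrightarrow> min x y \<in> {p<..<q}"
      obtain x0 y0 where xy: "r < x0" "x0 < s" "t < y0" "y0 < u"
        using dense[OF \<open>r < s\<close>] dense[OF \<open>t < u\<close>] by blast
      have "p \<le> r"
        by (rule dense_ge_bounded[OF \<open>r < s\<close>]) (use P xy in \<open>fastforce simp: min_less_iff_conj\<close>)
      moreover have "p \<le> t"
        by (rule dense_ge_bounded[OF \<open>t < u\<close>]) (use P xy in \<open>fastforce simp: min_less_iff_conj\<close>)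
      \<comment> \<open>Otherwise the rectangle contains a point with both coordinates above
        \<open>q\<close>.\<close>
      moreover have "s \<le> q \<or> u \<le> q"
      proof (rule ccontr)
        assume "\<not> (s \<le> q \<or> u \<le> q)"
        then obtain x y where "max q r < x" "x < s" "max q t < y" "y < u"
          using dense[of "max q r" s] dense[of "max q t" u] \<open>r < s\<close> \<open>t < u\<close> by auto
        then show False using P[of x y] by auto
      qed
      ultimately show "inf (ev f (between r s)) (ev g (between t u)) \<le> ev h (between p q)"
        unfolding ev_between h
        by (elim disjE)
          (auto intro!: le_infI intro: le_infI1 le_infI2 le_supI1 le_supI2 above_antimono below_mono)
    qed
  qed
  then show ?thesis by (simp add: inf_cont_def h)
qed

section \<open>Suprema over almost Boolean frames\<close>

text \<open>The closures of the pointwise suprema are complemented and antitone. (r5) is inherited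
  from any member of \<open>S\<close>, and \<open>bounded\<close> is (r6), since a triple
  pseudocomplement is a single one.\<close>

lemma has_supremum_extremally_disconnected:
  fixes S :: "'a::frame cont set"
  assumes ed: "extremally_disconnected TYPE('a)" and "S \<noteq> {}"
    and bounded: "(SUP p. pc (SUP x\<in>S. ev_above x p)) = top"
  shows "has_supremum S"
proof -
  define V where "V = (\<lambda>p. pc (pc (SUP x\<in>S. ev_above x p)))"
  have V_upper: "ev_above x p \<le> V p" if "x \<in> S" for x p
    unfolding V_def using that by (meson SUP_upper le_pc_pc order_trans)
  have antimono: "V p \<le> V q" if "q \<le> p" for p q
    unfolding V_def using that by (intro pc_antimono SUP_mono') (rule above_antimono)
  have "complemented (V p)" for p
    using ed by (simp add: V_def extremally_disconnected_def complemented_def sup.commute)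
  then have rb: "rather_below (V p) (V q)" if "q < p" for p q
    using antimono that by (intro rather_below_complemented) auto
  obtain x0 where "x0 \<in> S" using \<open>S \<noteq> {}\<close> by blast
  then have "(SUP p. ev_above x0 p) \<le> (SUP p. V p)" by (intro SUP_mono') (rule V_upper)
  then have tops: "(SUP p. V p) = top" "(SUP p. pc (V p)) = top"
    using bounded by (simp_all add: SUP_above top_unique V_def)
  obtain f where f: "\<And>p. ev_above f p = (SUP q\<in>{p<..}. V q)"
    using scale_cont[OF rb tops] by metis
  have "x \<le> f" if "x \<in> S" for x
    unfolding less_eq_cont_def f by (subst above_SUP) (auto intro!: SUP_mono' V_upper that)
  moreover have "f \<le> u" if u: "\<forall>x\<in>S. x \<le> u" for u
    unfolding less_eq_cont_def f
  proof (intro allI SUP_least)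
    fix p q :: rat assume "q \<in> {p<..}"
    then have "sup (ev_below u q) (ev_above u p) = top"
      using above_sup_below[of p q u] by (simp add: sup.commute)
    \<comment> \<open>Disjointness from a lower ray of \<open>u\<close> survives the passage to the
      closure, so the candidate stays below every upper bound.\<close>
    moreover have "inf (V q) (ev_below u q) = bot"
      unfolding V_def using u
      by (intro pc_pc_disjoint disjoint_mono[OF above_below_disjoint[of q q u]] SUP_least)
         (auto simp: less_eq_cont_def)
    ultimately show "V q \<le> ev_above u p" by (rule le_of_disjoint)
  qed
  ultimately show ?thesis unfolding has_supremum_def by blast
qed

text \<open>The lower rays of an upper bound cover, and each avoids the upper rays of all members at
  the same level.\<close>

lemma Dedekind_complete_cont:
  assumes "extremally_disconnected TYPE('a::frame)"
  shows "Dedekind_complete TYPE('a cont)"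
  unfolding Dedekind_complete_def
proof (intro allI impI, elim conjE)
  fix S :: "'a cont set" assume "S \<noteq> {}" "bdd_above S"
  then obtain g where g: "\<And>x. x \<in> S \<Longrightarrow> x \<le> g" by (auto simp: bdd_above_def)
  have "ev_below g p \<le> pc (SUP x\<in>S. ev_above x p)" for p
    unfolding le_pc_iff
    by (intro disjoint_mono[OF above_below_disjoint[of p p g]] SUP_least)
       (auto dest: g simp: less_eq_cont_def)
  then have "(SUP p. ev_below g p) \<le> (SUP p. pc (SUP x\<in>S. ev_above x p))" by (rule SUP_mono')
  then show "has_supremum S"
    using has_supremum_extremally_disconnected[OF assms \<open>S \<noteq> {}\<close>] by (simp add: SUP_below top_unique)
qed

text \<open>The obstruction is the part \<open>z\<close> where the supremum would be infinite. Where
  one member is positive the others contribute nothing, so \<open>z\<close> misses that part and is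
  \<open>bot\<close>. Hence the complements are dense in join, and closure under countable joins
  turns density into a cover.\<close>

lemma laterally_complete_cont:
  assumes ab: "almost_Boolean TYPE('a::frame)"
  shows "laterally_complete TYPE('a cont)"
  unfolding laterally_complete_def
proof (intro allI impI, elim conjE)
  fix S :: "'a cont set"
  assume "S \<noteq> {}" and disj: "pairwise (\<lambda>x y. inf x y = 0) S"
  have ed: "extremally_disconnected TYPE('a)" using ab by (simp add: almost_Boolean_def)
  define A where "A = (\<lambda>p. SUP x\<in>S. ev_above x p)"
  define z where "z = pc (SUP p. pc (A p))"
  have z_le: "z \<le> pc (pc (A p))" for p
    unfolding z_def by (rule pc_antimono) (rule SUP_upper, simp)
  have "inf (A p) (inf (ev_above x 0) (ev_below x p)) = bot" if "x \<in> S" "0 \<le> p" for x p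
  proof -
    have "inf (inf (ev_above x 0) (ev_below x p)) (ev_above y p) = bot" if "y \<in> S" for y
    proof (cases "y = x")
      case True
      then show ?thesis
        using disjoint_mono[OF above_below_disjoint[of p p x], of "ev_above x p" "inf (ev_above x 0) (ev_below x p)"]
        by (simp add: inf.commute)
    next
      case False
      then have "inf x y = 0" using disj \<open>x \<in> S\<close> that by (auto simp: pairwise_def)
      then have "inf (ev_above x 0) (ev_above y 0) = bot"
        by (simp add: zero_cont_def above_const flip: above_inf)
      then show ?thesis
        by (rule disjoint_mono[OF _ _ above_antimono[OF \<open>0 \<le> p\<close>]]) auto
    qed
    then show ?thesis unfolding A_def by (subst inf.commute) (simp add: inf_Sup_eq_bot)
  qed
  then have z_disj: "inf z (inf (ev_above x 0) (ev_below x p)) = bot" if "x \<in> S" "0 \<le> p" for x p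
    using that by (intro disjoint_mono[OF pc_pc_disjoint z_le order_refl])
  \<comment> \<open>A negative bound is enlarged to 0, where \<open>z_disj\<close> applies.\<close>
  have "inf (inf z (ev_above x 0)) (ev_below x p) = bot" if "x \<in> S" for x p
    using z_disj[OF that, of "max 0 p"]
    by (intro disjoint_mono[OF _ order_refl below_mono[of p "max 0 p" x]]) (simp_all add: inf.assoc)
  then have "inf (inf z (ev_above x 0)) (SUP p. ev_below x p) = bot" if "x \<in> S" for x
    using that by (simp add: inf_Sup_eq_bot)
  then have "inf z (A 0) = bot"
    unfolding A_def by (simp add: SUP_below inf_Sup_eq_bot)
  \<comment> \<open>\<open>z\<close> is disjoint from \<open>A 0\<close>, hence from its closure,
    yet lies below that closure.\<close>
  then have "z = bot"
    using z_le[of 0] by (metis inf.absorb1 inf.commute pc_pc_disjoint)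
  moreover have "complemented (SUP p. pc (A p))"
  proof -
    have "complemented (pc (A p))" for p
      using ed by (simp add: extremally_disconnected_def complemented_def)
    then show ?thesis using ab by (simp add: almost_Boolean_def)
  qed
  ultimately have "(SUP p. pc (A p)) = top" unfolding z_def by (intro complemented_dense)
  then show "has_supremum S"
    using has_supremum_extremally_disconnected[OF ed \<open>S \<noteq> {}\<close>] by (simp add: A_def)
qed

section \<open>Quasi-inverses over almost Boolean frames\<close>

text \<open>For \<open>p < q\<close> the closure of \<open>ev_above f q\<close> stays inside
  \<open>ev_above f p\<close>, separated by \<open>ev_below f q\<close>. So a ray is a countable
  join of closures, which are complemented.\<close>

lemma complemented_rays:
  assumes ab: "almost_Boolean TYPE('a::frame)"
  shows "complemented (ev_above (f::'a cont) p)" "complemented (ev_below f p)"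
proof -
  have cpl: "complemented (pc (pc a))" for a :: 'a
    using ab by (simp add: almost_Boolean_def extremally_disconnected_def complemented_def sup.commute)
  have Sup: "complemented (SUP q\<in>Q. pc (pc (h q)))" for Q :: "rat set" and h :: "rat \<Rightarrow> 'a"
    using ab cpl by (simp add: almost_Boolean_def)
  have "pc (pc (ev_above f q)) \<le> ev_above f p" if "p < q" for q
    using above_sup_below[OF that, of f] pc_pc_disjoint[OF above_below_disjoint[of q q f]]
    by (intro le_of_disjoint[of "ev_below f q"]) (simp_all add: sup.commute)
  then have "(SUP q\<in>{p<..}. pc (pc (ev_above f q))) = ev_above f p"
    by (intro antisym SUP_least, simp, subst above_SUP) (auto intro!: SUP_mono' le_pc_pc)
  with Sup show "complemented (ev_above f p)" by metis
  have "pc (pc (ev_below f q)) \<le> ev_below f p" if "q < p" for q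
    using above_sup_below[OF that, of f] pc_pc_disjoint[of "ev_below f q" "ev_above f q"]
      above_below_disjoint[of q q f]
    by (intro le_of_disjoint[of "ev_above f q"]) (simp_all add: inf.commute)
  then have "(SUP q\<in>{..<p}. pc (pc (ev_below f q))) = ev_below f p"
    by (intro antisym SUP_least, simp, subst below_SUP) (auto intro!: SUP_mono' le_pc_pc)
  with Sup show "complemented (ev_below f p)" by metis
qed

text \<open>The value of a product on an interval is again a join over rectangles, so an iterated
  product is tested on boxes with three sides.\<close>

lemma rects_times_leI:
  assumes "\<And>r s t u v w. (\<And>x y z. r < x \<Longrightarrow> x < s \<Longrightarrow> t < y \<Longrightarrow> y < u \<Longrightarrow> v < z \<Longrightarrow> z < w \<Longrightarrow> P (x * y) z) \<Longrightarrow>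
    inf (inf (ev f (between r s)) (ev g (between t u))) (ev k (between v w)) \<le> c"
  shows "rects P (f * g) k \<le> c"
proof (rule rects_leI)
  fix a b v w :: rat
  assume P: "\<And>x y. a < x \<Longrightarrow> x < b \<Longrightarrow> v < y \<Longrightarrow> y < w \<Longrightarrow> P x y"
  have "inf (ev k (between v w)) (rects (\<lambda>x y. a < x * y \<and> x * y < b) f g) \<le> c"
    unfolding rects_def
  proof (rule inf_Sup_le, clarify)
    fix r s t u :: rat assume "\<forall>x\<in>{r<..<s}. \<forall>y\<in>{t<..<u}. a < x * y \<and> x * y < b"
    then have "inf (inf (ev f (between r s)) (ev g (between t u))) (ev k (between v w)) \<le> c"
      using P by (intro assms) auto
    then show "inf (ev k (between v w)) (inf (ev f (between r s)) (ev g (between t u))) \<le> c"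
      by (simp add: inf.commute)
  qed
  then show "inf (ev (f * g) (between a b)) (ev k (between v w)) \<le> c"
    by (simp add: between_times inf.commute)
qed

text \<open>A nonzero box on which the two sides were separated by \<open>q < q'\<close> would
  contain a rational point with \<open>x * y * x = x\<close>, at which both sides agree.\<close>

lemma quasi_inverse:
  assumes witness: "\<And>r s t u. inf (ev f (between r s)) (ev g (between t u)) \<noteq> bot \<Longrightarrow>
    \<exists>x y. r < x \<and> x < s \<and> t < y \<and> y < u \<and> x * y * x = x"
  shows "f * g * f = f"
proof (rule antisym; rule cont_leI)
  fix q q' :: rat assume "q < q'"
  show "inf (ev_above (f * g * f) q') (ev_below f q) = bot"
  proof -
    have "rects (\<lambda>x y. q' < x * y) (f * g) f \<le> pc (ev_below f q)"
      unfolding le_pc_iff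
    proof (rule rects_times_leI[of _ _ _ _ "pc (ev_below f q)", unfolded le_pc_iff])
      fix r s t u v w :: rat
      assume P: "\<And>x y z. r < x \<Longrightarrow> x < s \<Longrightarrow> t < y \<Longrightarrow> y < u \<Longrightarrow> v < z \<Longrightarrow> z < w \<Longrightarrow> q' < x * y * z"
      \<comment> \<open>Both intervals of \<open>f\<close> and the ray merge into one interval, so
        that a single \<open>x\<close> serves both occurrences of \<open>f\<close>.\<close>
      have "inf (ev_below f q) (inf (inf (ev f (between r s)) (ev g (between t u))) (ev f (between v w)))
        = inf (ev f (between (max r v) (min (min s w) q))) (ev g (between t u))"
        unfolding ev_between inf_above[symmetric] inf_below[symmetric] by (simp add: ac_simps)
      also have "\<dots> = bot"
      proof (rule ccontr)
        assume "\<dots> \<noteq> bot"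
        then obtain x y where "max r v < x" "x < min (min s w) q" "t < y" "y < u"
            and xyx: "x * y * x = x"
          using witness by blast
        then show False using P[of x y x] \<open>q < q'\<close> unfolding xyx by simp
      qed
      finally show "inf (ev_below f q) (inf (inf (ev f (between r s)) (ev g (between t u))) (ev f (between v w))) = bot" .
    qed
    then show ?thesis by (simp add: above_times le_pc_iff inf.commute)
  qed
  show "inf (ev_above f q') (ev_below (f * g * f) q) = bot"
  proof -
    have "rects (\<lambda>x y. x * y < q) (f * g) f \<le> pc (ev_above f q')"
      unfolding le_pc_iff
    proof (rule rects_times_leI[of _ _ _ _ "pc (ev_above f q')", unfolded le_pc_iff])
      fix r s t u v w :: rat
      assume P: "\<And>x y z. r < x \<Longrightarrow> x < s \<Longrightarrow> t < y \<Longrightarrow> y < u \<Longrightarrow> v < z \<Longrightarrow> z < w \<Longrightarrow> x * y * z < q"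
      have "inf (ev_above f q') (inf (inf (ev f (between r s)) (ev g (between t u))) (ev f (between v w)))
        = inf (ev f (between (max (max r v) q') (min s w))) (ev g (between t u))"
        unfolding ev_between inf_above[symmetric] inf_below[symmetric] by (simp add: ac_simps)
      also have "\<dots> = bot"
      proof (rule ccontr)
        assume "\<dots> \<noteq> bot"
        then obtain x y where "max (max r v) q' < x" "x < min s w" "t < y" "y < u"
            and xyx: "x * y * x = x"
          using witness by blast
        then show False using P[of x y x] \<open>q < q'\<close> unfolding xyx by simp
      qed
      finally show "inf (ev_above f q') (inf (inf (ev f (between r s)) (ev g (between t u))) (ev f (between v w))) = bot" .
    qed
    then show ?thesis by (simp add: below_times le_pc_iff)
  qed
qed

text \<open>The corner \<open>(s, u)\<close> lies above the hyperbola and \<open>(r, t)\<close>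
  below it, so the hyperbola crosses the rectangle.\<close>

lemma reciprocal_in_rectangle:
  fixes r s t u :: rat
  assumes "0 \<le> r" "r < s" "t < u" "0 < u" "1 < u * s" "t * r < 1"
  shows "\<exists>x y. r < x \<and> x < s \<and> t < y \<and> y < u \<and> x * y = 1"
proof -
  have "\<exists>x. r < x \<and> x < s \<and> 1 < u * x \<and> t * x < 1"
  proof (cases "0 < t")
    case True
    have "max r (1 / u) < min s (1 / t)"
      using assms True by (auto simp: field_simps)
    then obtain x where "max r (1 / u) < x" "x < min s (1 / t)" using dense by blast
    then show ?thesis using assms True by (intro exI[of _ x]) (auto simp: field_simps)
  next
    case False
    have "max r (1 / u) < s" using assms by (auto simp: field_simps)
    then obtain x where x: "max r (1 / u) < x" "x < s" using dense by blast
    moreover have "t * x \<le> 0" using False x assms by (intro mult_nonpos_nonneg) auto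
    ultimately show ?thesis using assms by (intro exI[of _ x]) (auto simp: field_simps)
  qed
  then obtain x where x: "r < x" "x < s" "1 < u * x" "t * x < 1" by blast
  then show ?thesis using assms by (intro exI[of _ x] exI[of _ "1 / x"]) (auto simp: field_simps)
qed

lemma regular_ring_cont:
  assumes ab: "almost_Boolean TYPE('a::frame)"
  shows "regular_ring TYPE('a cont)"
  unfolding regular_ring_def
proof
  fix f :: "'a cont"
  note cpl = complemented_rays[OF ab, of f]
  \<comment> \<open>The scale of the function \<open>g\<close> that is \<open>1 / f\<close> off the
    zeros of \<open>f\<close> and 0 on them: the part where \<open>g\<close> is at least
    \<open>p\<close> if \<open>p\<close> is at most 0, and the part where \<open>g\<close> exceeds
    \<open>p\<close> if \<open>p\<close> is positive. This puts the zeros of \<open>f\<close> on the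
    correct side.\<close>
  define V where "V = (\<lambda>p. if p < 0 then pc (inf (ev_below f 0) (ev_above f (1 / p)))
    else if p = 0 then pc (ev_below f 0) else inf (ev_above f 0) (ev_below f (1 / p)))"
  have V_neg: "pc (V p) = inf (ev_below f 0) (ev_above f (1 / p))" if "p < 0" for p
    using that cpl by (simp add: V_def pc_pc_complemented complemented_inf)
  have V_zero: "V 0 = pc (ev_below f 0)" "pc (V 0) = ev_below f 0"
    using cpl by (simp_all add: V_def pc_pc_complemented)
  have V_pos: "V p = inf (ev_above f 0) (ev_below f (1 / p))" if "0 < p" for p
    using that by (simp add: V_def)
  have cplV: "complemented (V p)" for p
    using cpl by (simp add: V_def complemented_inf complemented_pc)
  have le0: "V 0 \<le> V p" if "p < 0" for p
    using that unfolding V_def by (simp add: pc_antimono)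
  have ge0: "V p \<le> V 0" if "0 < p" for p
    unfolding V_zero V_pos[OF that] le_pc_iff
    using disjoint_mono[OF above_below_disjoint[of 0 0 f]] by (subst inf.commute) auto
  have antimono: "V p \<le> V q" if "q \<le> p" for p q
  proof -
    consider "q = p" | "q < p" "p < 0" | "q \<le> 0" "0 \<le> p" | "0 < q" "q < p" using \<open>q \<le> p\<close> by linarith
    then show ?thesis
    proof cases
      case 2
      then show ?thesis
        unfolding V_def by (auto intro!: pc_antimono inf_mono above_antimono simp: field_simps)
    next
      case 3
      have "V p \<le> V 0" using ge0[of p] 3 by (cases "p = 0") auto
      also have "V 0 \<le> V q" using le0[of q] 3 by (cases "q = 0") auto
      finally show ?thesis .
    next
      case 4
      then show ?thesis
        by (auto simp: V_pos intro!: le_infI2 below_mono frac_le)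
    qed simp
  qed
  have rb: "rather_below (V p) (V q)" if "q < p" for p q
    using that by (intro rather_below_complemented cplV antimono) simp
  \<comment> \<open>Where \<open>f\<close> is below a negative \<open>q\<close>, its reciprocal is
    bounded below by \<open>1 / q\<close>; off the negative part \<open>V 0\<close> covers.\<close>
  have "sup (ev_below f 0) (pc (ev_below f 0)) \<le> (SUP p. V p)"
  proof (rule sup_least)
    have "ev_below f q \<le> (SUP p. V p)" if "q < 0" for q
    proof (rule SUP_upper2[of "1 / q"])
      have "inf (inf (ev_below f 0) (ev_above f q)) (ev_below f q) = bot"
        using disjoint_mono[OF above_below_disjoint[of q q f]] by auto
      then show "ev_below f q \<le> V (1 / q)" using that by (simp add: V_def le_pc_iff)
    qed simp
    then show "ev_below f 0 \<le> (SUP p. V p)" by (subst below_SUP) (auto intro: SUP_least)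
    show "pc (ev_below f 0) \<le> (SUP p. V p)" by (rule SUP_upper2[of 0]) (simp_all add: V_zero)
  qed
  then have top1: "(SUP p. V p) = top" using cpl(2)[of 0] by (simp only: complemented_def top_unique)
  \<comment> \<open>Where \<open>f\<close> is above a positive \<open>q\<close>, its reciprocal is
    at most \<open>1 / q\<close>; off the positive part any positive level, such as 1,
    works.\<close>
  have "sup (ev_above f 0) (pc (ev_above f 0)) \<le> (SUP p. pc (V p))"
  proof (rule sup_least)
    have "ev_above f q \<le> (SUP p. pc (V p))" if "0 < q" for q
    proof (rule SUP_upper2[of "1 / q"])
      have "inf (inf (ev_above f 0) (ev_below f q)) (ev_above f q) = bot"
        using disjoint_mono[OF above_below_disjoint[of q q f]] by (subst inf.commute) auto
      then show "ev_above f q \<le> pc (V (1 / q))" using that by (simp add: V_pos le_pc_iff)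
    qed simp
    then show "ev_above f 0 \<le> (SUP p. pc (V p))" by (subst above_SUP) (auto intro: SUP_least)
    show "pc (ev_above f 0) \<le> (SUP p. pc (V p))"
      by (rule SUP_upper2[of 1]) (simp_all add: V_pos pc_antimono)
  qed
  then have top2: "(SUP p. pc (V p)) = top" using cpl(1)[of 0] by (simp only: complemented_def top_unique)
  obtain g where g: "\<And>p. ev_above g p = (SUP q\<in>{p<..}. V q)" "\<And>p. ev_below g p = (SUP q\<in>{..<p}. pc (V q))"
    using scale_cont[OF rb top1 top2] by metis
  have g_le: "ev g (between t u) \<le> V p" if "p \<le> t" for t u p
    unfolding ev_between g using that by (intro le_infI1 SUP_least antimono) auto
  have g_le': "ev g (between t u) \<le> pc (V p)" if "u \<le> p" for t u p
    unfolding ev_between g using that by (intro le_infI2 SUP_least pc_antimono antimono) auto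
  have "\<exists>x y. r < x \<and> x < s \<and> t < y \<and> y < u \<and> x * y * x = x"
    if ne: "inf (ev f (between r s)) (ev g (between t u)) \<noteq> bot" for r s t u
  proof -
    have rs: "r < s"
      using ne ev_between_empty[of s r f] by (cases "r < s") (simp_all add: not_less)
    have tu: "t < u"
      using ne ev_between_empty[of u t g] by (cases "t < u") (simp_all add: not_less)
    \<comment> \<open>Enclosing the two intervals in disjoint elements contradicts
      \<open>ne\<close>; this forces the inequalities needed for
      \<open>reciprocal_in_rectangle\<close>.\<close>
    have no: False if "ev f (between r s) \<le> a" "ev g (between t u) \<le> b" "inf a b = bot" for a b
      using disjoint_mono[OF that(3,1,2)] ne by simp
    \<comment> \<open>A rectangle around \<open>x = 0\<close> contains a point with
      \<open>x = 0\<close>. On either side of it a point of the hyperbola is sought.\<close>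
    consider "r < 0" "0 < s" | "0 \<le> r" | "s \<le> 0" by linarith
    then show ?thesis
    proof cases
      case 1
      moreover obtain y where "t < y" "y < u" using dense[OF tu] by blast
      ultimately show ?thesis by (intro exI[of _ 0] exI[of _ y]) simp
    next
      case 2
      then have f_le: "ev f (between r s) \<le> ev_above f 0"
        unfolding ev_between by (intro le_infI1 above_antimono)
      have u: "0 < u"
      proof (rule ccontr)
        assume "\<not> 0 < u"
        then show False
          using no[OF f_le g_le'[of u 0]] by (simp add: V_zero(2) above_below_disjoint)
      qed
      have "1 < u * s"
      proof (rule ccontr)
        assume "\<not> 1 < u * s"
        then have "s \<le> 1 / u" using u by (simp add: field_simps)
        then have "ev f (between r s) \<le> V u"
          unfolding V_pos[OF u] using f_le by (simp add: ev_between le_infI2 below_mono)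
        then show False using no[OF _ g_le'[OF order_refl] inf_pc] by blast
      qed
      moreover have "t * r < 1"
      proof (rule ccontr)
        assume tr: "\<not> t * r < 1"
        then have t: "0 < t" using 2 mult_nonpos_nonneg[of t r] by (cases "0 < t") auto
        then have "1 / t \<le> r" using tr by (simp add: field_simps)
        then have "inf (ev_above f r) (V t) = bot"
          unfolding V_pos[OF t] using disjoint_mono[OF above_below_disjoint[of "1 / t" r f]] by auto
        then show False using no[OF _ g_le[OF order_refl], of "ev_above f r"] by (simp add: ev_between)
      qed
      ultimately obtain x y where "r < x" "x < s" "t < y" "y < u" "x * y = 1"
        using reciprocal_in_rectangle[OF 2 rs tu u] by blast
      then show ?thesis by (intro exI[of _ x] exI[of _ y]) simp
    next
      case 3
      then have f_le: "ev f (between r s) \<le> ev_below f 0"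
        unfolding ev_between by (intro le_infI2 below_mono)
      have t: "t < 0"
      proof (rule ccontr)
        assume "\<not> t < 0"
        then show False
          using no[OF f_le g_le[of 0 t]] by (simp add: V_zero(1))
      qed
      \<comment> \<open>Reflecting both coordinates moves the rectangle to the right
        half-plane.\<close>
      have "1 < (- t) * (- r)"
      proof (rule ccontr)
        assume "\<not> 1 < (- t) * (- r)"
        then have "1 / t \<le> r" using t by (simp add: field_simps)
        then have "ev f (between r s) \<le> pc (V t)"
          unfolding V_neg[OF t] using f_le by (simp add: ev_between le_infI1 above_antimono)
        then show False using no[OF _ g_le[OF order_refl] pc_inf] by blast
      qed
      moreover have "(- u) * (- s) < 1"
      proof (rule ccontr)
        assume us: "\<not> (- u) * (- s) < 1"
        then have u: "u < 0" using 3 mult_nonneg_nonpos[of u s] by (cases "u < 0") auto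
        then have "s \<le> 1 / u" using us by (simp add: field_simps)
        then have "inf (ev_below f s) (pc (V u)) = bot"
          unfolding V_neg[OF u] using disjoint_mono[OF above_below_disjoint[of s "1 / u" f]]
          by (subst inf.commute) auto
        then show False using no[OF _ g_le'[OF order_refl], of "ev_below f s"] by (simp add: ev_between)
      qed
      ultimately obtain x y where "- s < x" "x < - r" "- u < y" "y < - t" "x * y = 1"
        using reciprocal_in_rectangle[of "- s" "- r" "- u" "- t"] 3 rs tu t by auto
      then show ?thesis by (intro exI[of _ "- x"] exI[of _ "- y"]) auto
    qed
  qed
  then have "f * g * f = f" by (rule quasi_inverse)
  then show "\<exists>g. f = f * g * f" by metis
qed

section \<open>Necessity of the conditions\<close>

lemma completely_below_pc:
  assumes "completely_below b (a::'a::frame)"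
  shows "completely_below (pc a) (pc b)"
proof -
  obtain c :: "rat \<Rightarrow> 'a" where c: "b \<le> c 0" "c 1 \<le> a"
    "\<And>r s. 0 \<le> r \<Longrightarrow> r < s \<Longrightarrow> s \<le> 1 \<Longrightarrow> rather_below (c r) (c s)"
    using assms unfolding completely_below_def by blast
  show ?thesis
    unfolding completely_below_def
    by (rule exI[of _ "\<lambda>r. pc (c (1 - r))"]) (auto intro!: pc_antimono rather_below_pc c)
qed

text \<open>Urysohn's construction: the interpolating family read backwards is a scale, extended by
  \<open>top\<close> below 0 and by \<open>bot\<close> above 1.\<close>

lemma urysohn_cont:
  fixes a b :: "'a::frame"
  assumes "completely_below b a"
  obtains f :: "'a cont" where "\<And>p. p < 0 \<Longrightarrow> ev_above f p = top" "ev_above f 0 \<le> a"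
    "\<And>p. p < 1 \<Longrightarrow> b \<le> ev_above f p" "\<And>p. 1 \<le> p \<Longrightarrow> ev_above f p = bot"
proof -
  obtain c :: "rat \<Rightarrow> 'a" where c: "b \<le> c 0" "c 1 \<le> a"
    "\<And>r s. 0 \<le> r \<Longrightarrow> r < s \<Longrightarrow> s \<le> 1 \<Longrightarrow> rather_below (c r) (c s)"
    using assms unfolding completely_below_def by blast
  define V where "V = (\<lambda>p. if p < 0 then top else if p \<le> 1 then c (1 - p) else bot)"
  have rb: "rather_below (V p) (V q)" if "q < p" for p q
    using that unfolding V_def by (auto intro!: c(3)) (auto simp: rather_below_def)
  have tops: "(SUP p. V p) = top" "(SUP p. pc (V p)) = top"
    by (rule top_le, rule SUP_upper2[of "- 1"]; simp add: V_def)
       (rule top_le, rule SUP_upper2[of 2]; simp add: V_def)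
  obtain f where f: "\<And>p. ev_above f p = (SUP q\<in>{p<..}. V q)"
    using scale_cont[OF rb tops] by metis
  show thesis
  proof (rule that)
    show "ev_above f p = top" if "p < 0" for p
    proof -
      obtain q where "p < q" "q < 0" using dense[OF \<open>p < 0\<close>] by blast
      then show ?thesis unfolding f by (intro top_le SUP_upper2[of q]) (auto simp: V_def)
    qed
    have "V q \<le> a" if "0 < q" for q
      using that c(2) rather_below_le[OF c(3)[of "1 - q" 1]] unfolding V_def by auto
    then show "ev_above f 0 \<le> a" unfolding f by (auto intro: SUP_least)
    show "b \<le> ev_above f p" if "p < 1" for p
      unfolding f using that c(1) by (intro SUP_upper2[of 1]) (auto simp: V_def)
    show "ev_above f p = bot" if "1 \<le> p" for p
      unfolding f using that by (intro antisym SUP_least) (auto simp: V_def)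
  qed
qed

text \<open>The supremum \<open>F\<close> exceeds 1/2 on \<open>a\<close> and is nowhere positive on
  \<open>pc a\<close>, so (r2) for \<open>F\<close> at 0 and 1/2 gives the required cover.\<close>

lemma extremally_disconnectedI:
  assumes cr: "completely_regular_frame TYPE('a::frame)"
    and "Dedekind_complete TYPE('a cont)"
  shows "extremally_disconnected TYPE('a)"
  unfolding extremally_disconnected_def
proof
  fix a :: 'a
  define S where "S = {f::'a cont. f \<le> 1 \<and> ev_above f 0 \<le> a}"
  have "0 \<in> S"
    by (auto simp: S_def zero_cont_def one_cont_def less_eq_cont_def above_const)
  moreover have "bdd_above S" by (rule bdd_aboveI[of _ 1]) (simp add: S_def)
  ultimately have "has_supremum S"
    using assms(2) unfolding Dedekind_complete_def by blast
  then obtain F where F: "\<And>f. f \<in> S \<Longrightarrow> f \<le> F" "\<And>h. (\<And>f. f \<in> S \<Longrightarrow> f \<le> h) \<Longrightarrow> F \<le> h"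
    unfolding has_supremum_def by metis
  have join: "c = Sup {b. completely_below b c}" for c :: 'a
    using cr unfolding completely_regular_frame_def by blast
  have "b \<le> ev_above F (1/2)" if b: "completely_below b a" for b
  proof -
    obtain f where f: "\<And>p. p < 0 \<Longrightarrow> ev_above f p = top" "ev_above f 0 \<le> a"
      "\<And>p. p < 1 \<Longrightarrow> b \<le> ev_above f p" "\<And>p. 1 \<le> p \<Longrightarrow> ev_above f p = bot"
      using urysohn_cont[OF b] by metis
    have "f \<in> S"
      unfolding S_def by (simp add: f(2) less_eq_cont_def one_cont_def above_const) (auto simp: f(4))
    then have "ev_above f (1/2) \<le> ev_above F (1/2)" using F(1) by (simp add: less_eq_cont_def)
    with f(3)[of "1/2"] show ?thesis by (auto intro: order_trans)
  qed
  then have "a \<le> ev_above F (1/2)" by (subst join) (auto intro: Sup_least)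
  then have le1: "ev_below F (1/2) \<le> pc a"
    unfolding le_pc_iff using disjoint_mono[OF above_below_disjoint[of "1/2" "1/2" F]] by blast
  have "inf (ev_above F 0) c = bot" if c: "completely_below c (pc a)" for c
  proof -
    \<comment> \<open>\<open>h\<close> is at least 1 on the closure of \<open>a\<close> and not
      positive on \<open>c\<close>. Hence it bounds \<open>S\<close>, and \<open>F\<close> is not
      positive on \<open>c\<close> either.\<close>
    obtain h where h: "\<And>p. p < 0 \<Longrightarrow> ev_above h p = top" "ev_above h 0 \<le> pc c"
      "\<And>p. p < 1 \<Longrightarrow> pc (pc a) \<le> ev_above h p"
      using urysohn_cont[OF completely_below_pc[OF c]] by metis
    have "f \<le> h" if "f \<in> S" for f
      unfolding less_eq_cont_def
    proof
      fix p :: rat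
      consider "p < 0" | "0 \<le> p" "p < 1" | "1 \<le> p" by linarith
      then show "ev_above f p \<le> ev_above h p"
      proof cases
        case 2
        have "ev_above f p \<le> ev_above f 0" using 2 by (intro above_antimono)
        also have "\<dots> \<le> a" using that by (simp add: S_def)
        also note le_pc_pc
        also have "pc (pc a) \<le> ev_above h p" using 2 by (intro h)
        finally show ?thesis .
      next
        case 3
        have "ev_above f p \<le> ev_above 1 p" using that by (simp add: S_def less_eq_cont_def)
        with 3 show ?thesis by (simp add: one_cont_def above_const bot_unique)
      qed (simp add: h)
    qed
    then have "ev_above F 0 \<le> ev_above h 0" using F(2)[of h] by (simp add: less_eq_cont_def)
    then show ?thesis using h(2) by (metis inf.commute le_pc_iff order_trans)
  qed
  then have "inf (ev_above F 0) (pc a) = bot"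
    by (subst join) (simp add: inf_Sup_eq_bot)
  then have "ev_above F 0 \<le> pc (pc a)" by (simp add: le_pc_iff inf.commute)
  then have "sup (ev_above F 0) (ev_below F (1/2)) \<le> sup (pc (pc a)) (pc a)"
    using le1 by (rule sup_mono)
  then show "sup (pc a) (pc (pc a)) = top"
    using above_sup_below[of 0 "1/2" F] by (simp add: sup.commute top_unique)
qed

section \<open>Countable joins of complemented elements\<close>

lemma complemented_partial_joins:
  fixes d :: "nat \<Rightarrow> 'a::frame"
  shows "(\<And>n. complemented (d n)) \<Longrightarrow> complemented (SUP i\<in>{..<n}. d i)"
  by (induction n) (simp_all add: lessThan_Suc complemented_sup)

text \<open>With \<open>e = f * g\<close> one has \<open>e * f = f\<close>. So
  \<open>e > 1/2\<close> forces \<open>f > 0\<close>, while \<open>e < 1\<close> excludes it, and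
  these two rays of \<open>e\<close> cover.\<close>

lemma complemented_positive_part:
  assumes fgf: "f = f * g * f" and nonneg: "ev_below f 0 = (bot::'a::frame)"
  shows "complemented (ev_above f 0)"
proof -
  define e where "e = f * g"
  have "rects (\<lambda>x y. 1/2 < x * y) f g \<le> ev_above f 0"
  proof (rule rects_leI)
    fix r s t u :: rat assume "r < s" and tu: "t < u"
      and P: "\<And>x y. r < x \<Longrightarrow> x < s \<Longrightarrow> t < y \<Longrightarrow> y < u \<Longrightarrow> 1/2 < x * y"
    obtain y where y: "t < y" "y < u" using dense[OF tu] by blast
    \<comment> \<open>No rectangle around \<open>x = 0\<close> qualifies, since the product vanishes
      at \<open>x = 0\<close>.\<close>
    consider "0 \<le> r" | "s \<le> 0" using P[of 0 y] y by force
    then show "inf (ev f (between r s)) (ev g (between t u)) \<le> ev_above f 0"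
    proof cases
      case 1
      then show ?thesis unfolding ev_between by (intro le_infI1 above_antimono)
    next
      case 2
      then show ?thesis
        using below_mono[OF 2, of f] nonneg by (simp add: ev_between bot_unique)
    qed
  qed
  then have le: "ev_above e (1/2) \<le> ev_above f 0" by (simp add: e_def above_times)
  have disj: "inf (ev_above f r) (ev_below e q) \<le> bot" if r: "0 < r" and q: "0 < q" "q < 1" for r q
  proof (rule inf_between_cover)
    \<comment> \<open>This length keeps \<open>q * s\<close> at most \<open>r'\<close>; then
      \<open>e < q\<close> would give \<open>e * f < q * s\<close> where
      \<open>f > r'\<close>.\<close>
    show "0 < (1 - q) * r" using r q by simp
    fix a
    define r' s where "r' = max a r" and "s = a + (1 - q) * r"
    have qs: "q * s \<le> r'"
    proof -
      have "q * s \<le> q * (r' + (1 - q) * r')"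
        using q r unfolding s_def r'_def by (intro mult_left_mono add_mono) auto
      also have "\<dots> = r' - (1 - q) * (1 - q) * r'" by (simp add: algebra_simps)
      also have "\<dots> \<le> r'" using q r by (simp add: r'_def)
      finally show ?thesis .
    qed
    have "inf (ev f (between r' s)) (ev e (between t q)) = bot" for t
    proof -
      have "inf (ev e (between t q)) (ev f (between r' s)) \<le> rects (\<lambda>x y. x * y < q * s) e f"
      proof (rule rects_upper)
        fix x y :: rat assume xy: "x < q" "r' < y" "y < s"
        have "0 < y" using r xy by (simp add: r'_def)
        then have "x * y < q * y" using xy by simp
        also have "\<dots> < q * s" using xy q by simp
        finally show "x * y < q * s" .
      qed
      also have "\<dots> = ev_below f (q * s)"
        using fgf by (simp flip: below_times add: e_def)
      finally have "inf (inf (ev e (between t q)) (ev f (between r' s))) (ev_above f r') = bot"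
        using disjoint_mono[OF above_below_disjoint[OF qs, of f]] by (metis inf.commute order_refl)
      then show ?thesis by (simp add: ev_between ac_simps)
    qed
    then have "inf (ev f (between r' s)) (ev_below e q) = bot"
      by (simp add: below_between[of e q] inf_Sup_eq_bot)
    moreover have "inf (ev f (between a (a + (1 - q) * r))) (inf (ev_above f r) (ev_below e q))
      = inf (ev f (between r' s)) (ev_below e q)"
      unfolding r'_def s_def ev_between inf_above[symmetric] by (simp add: ac_simps)
    ultimately show "inf (ev f (between a (a + (1 - q) * r))) (inf (ev_above f r) (ev_below e q)) \<le> bot"
      by simp
  qed
  have "inf (ev_above f r) (ev_below e q) = bot" if "0 < r" "q < 1" for r q
  proof -
    have "inf (ev_above f r) (ev_below e (max q (1/2))) = bot"
      using disj[OF that(1), of "max q (1/2)"] that(2) by (simp add: bot_unique)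
    then show ?thesis by (rule disjoint_mono) (auto intro: below_mono)
  qed
  then have "inf (ev_above f r) (ev_below e 1) = bot" if "0 < r" for r
    using that by (subst below_SUP) (auto simp: inf_Sup_eq_bot)
  then have "inf (ev_below e 1) (ev_above f 0) = bot"
    by (subst above_SUP) (auto simp: inf_Sup_eq_bot inf.commute)
  then have "ev_below e 1 \<le> pc (ev_above f 0)" by (simp add: le_pc_iff inf.commute)
  then have "sup (ev_above e (1/2)) (ev_below e 1) \<le> sup (ev_above f 0) (pc (ev_above f 0))"
    using le by (intro sup_mono)
  then show ?thesis by (simp add: complemented_def above_sup_below top_unique)
qed

text \<open>Regularity is applied to the supremum of the functions with value
  \<open>1 / (i + 1)\<close> on \<open>d i\<close>. Each positive level involves finitely many
  \<open>d i\<close>, and the positive part is the whole join.\<close>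

lemma complemented_SUP_if_regular:
  fixes d :: "nat \<Rightarrow> 'a::frame"
  assumes reg: "regular_ring TYPE('a cont)" and d: "\<And>n. complemented (d n)"
  shows "complemented (SUP n. d n)"
proof -
  \<comment> \<open>For positive \<open>p\<close>, the index bound on \<open>i\<close> says that
    \<open>p\<close> is at most \<open>1 / (i + 1)\<close>.\<close>
  define V where "V = (\<lambda>p::rat. if p \<le> 0 then top else SUP i\<in>{..<nat \<lfloor>1 / p\<rfloor>}. d i)"
  have "complemented (V p)" for p
    using d by (simp add: V_def complemented_partial_joins)
  moreover have "V p \<le> V q" if "q < p" for p q
  proof -
    have "1 / p \<le> 1 / q" if "0 < q" using that \<open>q < p\<close> by (intro frac_le) auto
    then have "nat \<lfloor>1 / p\<rfloor> \<le> nat \<lfloor>1 / q\<rfloor>" if "0 < q" using that by (intro nat_mono floor_mono)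
    then show ?thesis using that unfolding V_def by (auto intro!: SUP_subset_mono)
  qed
  ultimately have rb: "rather_below (V p) (V q)" if "q < p" for p q
    using that by (intro rather_below_complemented)
  \<comment> \<open>At level 2 the floor is 0, so the join is empty.\<close>
  have tops: "(SUP p. V p) = top" "(SUP p. pc (V p)) = top"
    by (rule top_le, rule SUP_upper2[of 0]; simp add: V_def)
       (rule top_le, rule SUP_upper2[of 2]; simp add: V_def)
  obtain f where f: "\<And>p. ev_above f p = (SUP q\<in>{p<..}. V q)" "\<And>p. ev_below f p = (SUP q\<in>{..<p}. pc (V q))"
    using scale_cont[OF rb tops] by metis
  have "ev_below f 0 = bot"
    unfolding f by (intro antisym SUP_least) (auto simp: V_def)
  moreover obtain g where "f = f * g * f" using reg unfolding regular_ring_def by blast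
  ultimately have "complemented (ev_above f 0)" by (intro complemented_positive_part)
  moreover have "ev_above f 0 = (SUP n. d n)"
    unfolding f
  proof (intro antisym SUP_least)
    show "V q \<le> (SUP n. d n)" if "q \<in> {0<..}" for q
      using that by (auto simp: V_def intro!: SUP_subset_mono)
    show "d n \<le> (SUP q\<in>{0<..}. V q)" for n
      by (rule SUP_upper2[of "1 / of_nat (Suc n)"]) (auto simp: V_def nat_add_distrib intro!: SUP_upper)
  qed
  ultimately show ?thesis by simp
qed

text \<open>A supremum of the functions with value \<open>n\<close> on the \<open>n\<close>-th of the disjointified pieces is
  unbounded along the join of the pieces, which therefore cannot accumulate anywhere.\<close>

lemma complemented_SUP_if_laterally_complete:
  fixes d :: "nat \<Rightarrow> 'a::frame"
  assumes lat: "laterally_complete TYPE('a cont)" and d: "\<And>n. complemented (d n)"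
  shows "complemented (SUP n. d n)"
proof -
  define a where "a = (\<lambda>n. SUP i\<in>{..<n}. d i)"
  define D where "D = (\<lambda>n. inf (d n) (pc (a n)))"
  have cpl_a: "complemented (a n)" for n
    using d by (simp add: a_def complemented_partial_joins)
  have a_Suc: "a (Suc n) = sup (a n) (d n)" for n
    by (simp add: a_def lessThan_Suc sup.commute)
  have d_le: "d i \<le> a n" if "i < n" for i n
    unfolding a_def using that by (intro SUP_upper) simp
  have D_disj: "inf (D n) (D m) = bot" if "n \<noteq> m" for n m
  proof -
    have "inf (D n) (D m) = bot" if "n < m" for n m
      unfolding D_def by (rule disjoint_mono[OF inf_pc[of "a m"]]) (auto intro: le_infI1 d_le that)
    then show ?thesis using that by (metis inf.commute linorder_neqE_nat)
  qed
  have "\<exists>x::'a cont. (\<forall>p<0. ev_above x p = top) \<and> (\<forall>p\<ge>0. ev_above x p \<le> D n) \<and>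
      (\<forall>p<of_nat n. D n \<le> ev_above x p)" for n
  proof -
    \<comment> \<open>The scale of \<open>n\<close> times the indicator of
      \<open>D n\<close>.\<close>
    define V where "V = (\<lambda>p::rat. if p < 0 then top else if p \<le> of_nat n then D n else bot)"
    have "complemented (V p)" for p
      using d cpl_a by (simp add: V_def D_def complemented_inf complemented_pc)
    moreover have "V p \<le> V q" if "q < p" for p q using that by (auto simp: V_def)
    ultimately have rb: "rather_below (V p) (V q)" if "q < p" for p q
      using that by (intro rather_below_complemented)
    have tops: "(SUP p. V p) = top" "(SUP p. pc (V p)) = top"
      by (rule top_le, rule SUP_upper2[of "- 1"]; simp add: V_def)
         (rule top_le, rule SUP_upper2[of "of_nat n + 1"]; simp add: V_def)
    obtain x where x: "\<And>p. ev_above x p = (SUP q\<in>{p<..}. V q)"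
      using scale_cont[OF rb tops] by metis
    have "ev_above x p = top" if "p < 0" for p
    proof -
      obtain q where "p < q" "q < 0" using dense[OF \<open>p < 0\<close>] by blast
      then show ?thesis unfolding x by (intro top_le SUP_upper2[of q]) (auto simp: V_def)
    qed
    moreover have "ev_above x p \<le> D n" if "0 \<le> p" for p
      unfolding x using that by (intro SUP_least) (auto simp: V_def)
    moreover have "D n \<le> ev_above x p" if "p < of_nat n" for p
      unfolding x using that by (intro SUP_upper2[of "of_nat n"]) (auto simp: V_def)
    ultimately show ?thesis by blast
  qed
  then obtain x :: "nat \<Rightarrow> 'a cont" where x_neg: "\<And>n p. p < 0 \<Longrightarrow> ev_above (x n) p = top"
    and x_le: "\<And>n p. 0 \<le> p \<Longrightarrow> ev_above (x n) p \<le> D n"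
    and x_ge: "\<And>n p. p < of_nat n \<Longrightarrow> D n \<le> ev_above (x n) p"
    by metis
  have "inf (x n) (x m) = 0" if "n \<noteq> m" for n m
  proof (rule cont_eqI)
    fix p
    show "ev_above (inf (x n) (x m)) p = ev_above 0 p"
    proof (cases "p < 0")
      case True
      then show ?thesis by (simp add: above_inf x_neg zero_cont_def above_const)
    next
      case False
      then show ?thesis
        using disjoint_mono[OF D_disj[OF that] x_le x_le, of p p]
        by (simp add: above_inf zero_cont_def above_const)
    qed
  qed
  then have "pairwise (\<lambda>x y. inf x y = 0) (range x)" unfolding pairwise_def by (metis rangeE)
  moreover have "\<forall>y\<in>range x. 0 \<le> y" by (simp add: nonneg_cont_iff x_neg)
  ultimately have "has_supremum (range x)"
    using lat unfolding laterally_complete_def by blast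
  then obtain F where F: "\<And>n. x n \<le> F" unfolding has_supremum_def by auto
  define A where "A = (SUP n. d n)"
  \<comment> \<open>\<open>F\<close> is at least \<open>m\<close> on \<open>D m\<close>.\<close>
  have D_F: "inf (D m) (ev_below F (of_nat n)) = bot" if "n < m" for m n
  proof (rule disjoint_mono[OF above_below_disjoint[of "of_nat n" "of_nat n" F]])
    have "D m \<le> ev_above (x m) (of_nat n)" using that by (intro x_ge) simp
    also have "\<dots> \<le> ev_above F (of_nat n)" using F by (simp add: less_eq_cont_def)
    finally show "D m \<le> ev_above F (of_nat n)" .
  qed simp_all
  \<comment> \<open>Where \<open>F < n\<close>, pieces of index above \<open>n\<close> are absent,
    so every partial join reduces to the first \<open>n + 1\<close> terms.\<close>
  have a_F: "inf (a m) (ev_below F (of_nat n)) \<le> a (Suc n)" for m n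
  proof (induction m)
    case 0
    then show ?case by (simp add: a_def)
  next
    case (Suc m)
    show ?case
    proof (cases "m \<le> n")
      case True
      then have "a (Suc m) \<le> a (Suc n)" unfolding a_def by (intro SUP_subset_mono) auto
      then show ?thesis by (rule le_infI1)
    next
      case False
      have "a (Suc m) = sup (a m) (D m)"
        using cpl_a[of m] by (simp add: a_Suc D_def sup_inf_distrib1 complemented_def)
      then show ?thesis using Suc.IH D_F[of n m] False by (simp add: inf_sup_distrib2)
    qed
  qed
  \<comment> \<open>Where \<open>F < n\<close>, \<open>A\<close> agrees with the complemented
    element \<open>a (Suc n)\<close>, whose complement there lies below \<open>pc A\<close>.\<close>
  have "ev_below F (of_nat n) \<le> sup A (pc A)" for n
  proof -
    let ?b = "inf (ev_below F (of_nat n)) (pc (a (Suc n)))"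
    have "inf ?b (d i) = bot" for i
    proof -
      have "inf (d i) (ev_below F (of_nat n)) \<le> a (Suc n)"
        using a_F[of "Suc i" n] d_le[of i "Suc i"] by (meson inf_mono lessI order_refl order_trans)
      from disjoint_mono[OF inf_pc this order_refl] show ?thesis by (simp add: ac_simps)
    qed
    then have "?b \<le> pc A" by (subst le_pc_iff, subst inf.commute) (simp add: A_def inf_Sup_eq_bot)
    moreover have "a (Suc n) \<le> A" unfolding a_def A_def by (intro SUP_subset_mono) auto
    moreover have "ev_below F (of_nat n) \<le> sup (a (Suc n)) ?b"
      using cpl_a[of "Suc n"] by (simp add: sup_inf_distrib1 complemented_def)
    ultimately show ?thesis by (meson order_trans sup_mono)
  qed
  \<comment> \<open>Natural bounds are cofinal, so (r6) makes these parts cover.\<close>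
  then have "ev_below F p \<le> sup A (pc A)" for p
    using reals_Archimedean2[of p] below_mono[of p _ F] by (meson less_imp_le order_trans)
  then have "(SUP p. ev_below F p) \<le> sup A (pc A)" by (rule SUP_least)
  then show ?thesis by (simp add: SUP_below complemented_def A_def top_unique)
qed

text \<open>Enumerating a countable set reduces its join to that of a sequence; the empty set has no
  enumeration and is treated apart.\<close>

lemma almost_BooleanI:
  assumes cr: "completely_regular_frame TYPE('a::frame)"
    and "Dedekind_complete TYPE('a cont)"
    and SUP: "\<And>d :: nat \<Rightarrow> 'a. (\<And>n. complemented (d n)) \<Longrightarrow> complemented (SUP n. d n)"
  shows "almost_Boolean TYPE('a)"
  unfolding almost_Boolean_def
proof (intro conjI allI impI)
  show "regular_frame TYPE('a)"
    unfolding regular_frame_def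
  proof
    fix a :: 'a
    have "a = Sup {b. completely_below b a}"
      using cr unfolding completely_regular_frame_def by blast
    also have "\<dots> \<le> Sup {b. rather_below b a}"
      by (rule Sup_subset_mono) (auto intro: completely_below_imp_rather_below)
    finally show "a = Sup {b. rather_below b a}"
      by (rule antisym) (auto intro: Sup_least rather_below_le)
  qed
  show "extremally_disconnected TYPE('a)"
    using assms(1,2) by (rule extremally_disconnectedI)
  fix A :: "'a set" assume A: "countable A \<and> (\<forall>a\<in>A. complemented a)"
  show "complemented (Sup A)"
  proof (cases "A = {}")
    case False
    then have "range (from_nat_into A) = A" using A by (intro range_from_nat_into) auto
    then show ?thesis using SUP[of "from_nat_into A"] A by (metis rangeI)
  qed simp
qed

theorem corollary5p3:
  assumes "completely_regular_frame TYPE('a::frame)"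
  shows "(almost_Boolean TYPE('a) \<longleftrightarrow>
            Dedekind_complete TYPE('a cont) \<and> regular_ring TYPE('a cont)) \<and>
         (Dedekind_complete TYPE('a cont) \<and> regular_ring TYPE('a cont) \<longleftrightarrow>
            universally_complete TYPE('a cont))"
proof -
  \<comment> \<open>Everything follows from \<open>almost_Boolean\<close>. The two converses share
    extremal disconnectedness and differ only in the source of the countable joins.\<close>
  have "Dedekind_complete TYPE('a cont)" "regular_ring TYPE('a cont)"
      "laterally_complete TYPE('a cont)" if ab: "almost_Boolean TYPE('a)"
  proof -
    show "Dedekind_complete TYPE('a cont)"
      using ab by (intro Dedekind_complete_cont) (simp add: almost_Boolean_def)
  qed (fact regular_ring_cont[OF ab] laterally_complete_cont[OF ab])+
  moreover have "almost_Boolean TYPE('a)"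
    if "Dedekind_complete TYPE('a cont)" "regular_ring TYPE('a cont)"
    using almost_BooleanI[OF assms that(1)] complemented_SUP_if_regular[OF that(2)] by blast
  moreover have "almost_Boolean TYPE('a)"
    if "Dedekind_complete TYPE('a cont)" "laterally_complete TYPE('a cont)"
    using almost_BooleanI[OF assms that(1)] complemented_SUP_if_laterally_complete[OF that(2)] by blast
  ultimately show ?thesis unfolding universally_complete_def by blast
qed

end
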